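(* Let $G=(V,E)$ be a connected graph with $n=|V|\ge2$, weights $w$ and costs $c$, and let $\Delta>0$. Suppose there is $F^*\subseteq E$ with $c(F^* )=B$ and $p_G(F^* )=\Delta$ (finite). Run the greedy procedure below with input budget $B'\ge B$, and assume every edge set whose removal disconnects $G$ has cost greater than $B'$. Then the output $F$ satisfies $p_G(F)\ge\Delta$ (and, by the stopping rule, $c(F)<(2+2\log n)B'$). Greedy procedure (input $G,B',\Delta$; $\mathcal{W}=\{w(e):e\in E\}$): initialize $F=\emptyset$, $b=0$, $G'=(V,E')=G$. Repeat the following step: for every edge $\{u,v\}\in E'$ and every $W\in\mathcal{W}$, let $C$ be a minimum-cost set of edges of $G''=(V,\{f\in E':w(f)<W\})$ separating $u$ from $v$ in $G''$, and $p=W-w(\{u,v\})$; among all such $(C,p)$ with $0<c(C)\le B'$ choose $C^*$ maximizing $p/c(C)$, and let $r^*$ be this maximum (if no candidate has positive ratio, $r^*=0$ and $C^*=\emptyset$). Then set $G'\leftarrow G'\setminus C^*$, $b\leftarrow b+c(C^* )$, $F\leftarrow F\cup C^*$. Repeat the step as long as $r^*>0$, $b<(1+2\log n)B'$ and $p_G(F)<\Delta$. Finally output $F$ if $p_G(F)\ge\Delta$, and $\emptyset$ otherwise.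
   Context: $w:E\to\mathbb{R}_{\ge0}$, $c:E\to\mathbb{R}_{>0}$, $c(D)=\sum_{f\in D}c(f)$, $G\setminus D=(V,E\setminus D)$. $\mathrm{MST}(\cdot)$ is minimum spanning tree weight w.r.t. $w$ ($\infty$ for disconnected graphs); $p_G(D)=\mathrm{MST}(G\setminus D)-\mathrm{MST}(G)$. $\log=\log_2$. *)

theory Defs
  imports Complex_Main "HOL-Library.Extended_Real"
begin

definition simple_graph :: "'a set \<Rightarrow> 'a set set \<Rightarrow> bool" where
  "simple_graph V E \<longleftrightarrow> finite V \<and> (\<forall>e\<in>E. \<exists>u v. e = {u, v} \<and> u \<noteq> v \<and> u \<in> V \<and> v \<in> V)"

definition reach :: "'a set set \<Rightarrow> 'a \<Rightarrow> 'a \<Rightarrow> bool" where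
  "reach E u v \<longleftrightarrow> (u, v) \<in> {(x, y). {x, y} \<in> E}\<^sup>*"

definition connected_graph :: "'a set \<Rightarrow> 'a set set \<Rightarrow> bool" where
  "connected_graph V E \<longleftrightarrow> (\<forall>u\<in>V. \<forall>v\<in>V. reach E u v)"

definition spanning_tree :: "'a set \<Rightarrow> 'a set set \<Rightarrow> 'a set set \<Rightarrow> bool" where
  "spanning_tree V E T \<longleftrightarrow> T \<subseteq> E \<and> connected_graph V T \<and>
     (\<forall>e\<in>T. \<not> connected_graph V (T - {e}))"

definition MST :: "'a set \<Rightarrow> 'a set set \<Rightarrow> ('a set \<Rightarrow> real) \<Rightarrow> ereal" where
  "MST V E w = (if \<exists>T. spanning_tree V E T
                then ereal (Min {sum w T | T. spanning_tree V E T}) else \<infinity>)"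

definition pG :: "'a set \<Rightarrow> 'a set set \<Rightarrow> ('a set \<Rightarrow> real) \<Rightarrow> 'a set set \<Rightarrow> ereal" where
  "pG V E w D = MST V (E - D) w - MST V E w"

definition cost :: "('a set \<Rightarrow> real) \<Rightarrow> 'a set set \<Rightarrow> real" where
  "cost c D = sum c D"

definition separates :: "'a set set \<Rightarrow> 'a set set \<Rightarrow> 'a \<Rightarrow> 'a \<Rightarrow> bool" where
  "separates E'' C u v \<longleftrightarrow> C \<subseteq> E'' \<and> \<not> reach (E'' - C) u v"

definition min_cost_sep :: "('a set \<Rightarrow> real) \<Rightarrow> 'a set set \<Rightarrow> 'a set set \<Rightarrow> 'a \<Rightarrow> 'a \<Rightarrow> bool" where
  "min_cost_sep c E'' C u v \<longleftrightarrow> separates E'' C u v \<and>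
     (\<forall>C'. separates E'' C' u v \<longrightarrow> cost c C \<le> cost c C')"

definition candidate ::
  "'a set set \<Rightarrow> ('a set \<Rightarrow> real) \<Rightarrow> ('a set \<Rightarrow> real) \<Rightarrow> real \<Rightarrow> 'a set set
     \<Rightarrow> 'a set \<Rightarrow> real \<Rightarrow> 'a set set \<Rightarrow> bool" where
  "candidate E w c B' E' e W C \<longleftrightarrow> e \<in> E' \<and> W \<in> w ` E \<and>
     (\<exists>u v. e = {u, v} \<and> min_cost_sep c {f \<in> E'. w f < W} C u v) \<and>
     0 < cost c C \<and> cost c C \<le> B'"

definition cand_ratios ::
  "'a set set \<Rightarrow> ('a set \<Rightarrow> real) \<Rightarrow> ('a set \<Rightarrow> real) \<Rightarrow> real \<Rightarrow> 'a set set \<Rightarrow> real set" where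
  "cand_ratios E w c B' E' =
     {(W - w e) / cost c C | e W C. candidate E w c B' E' e W C}"

definition rstar ::
  "'a set set \<Rightarrow> ('a set \<Rightarrow> real) \<Rightarrow> ('a set \<Rightarrow> real) \<Rightarrow> real \<Rightarrow> 'a set set \<Rightarrow> real" where
  "rstar E w c B' E' = Max (insert 0 (cand_ratios E w c B' E'))"

definition greedy_choice ::
  "'a set set \<Rightarrow> ('a set \<Rightarrow> real) \<Rightarrow> ('a set \<Rightarrow> real) \<Rightarrow> real \<Rightarrow> 'a set set \<Rightarrow> 'a set set \<Rightarrow> bool" where
  "greedy_choice E w c B' E' Cs \<longleftrightarrow>
     (if 0 < rstar E w c B' E'
      then (\<exists>e W. candidate E w c B' E' e W Cs \<and> (W - w e) / cost c Cs = rstar E w c B' E')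
      else Cs = {})"

(* A complete run with k \<ge> 1 executed steps; Fs i, bs i, Es i is the state after i steps,
   rs i is the value r* computed in step i. *)
definition greedy_run ::
  "'a set \<Rightarrow> 'a set set \<Rightarrow> ('a set \<Rightarrow> real) \<Rightarrow> ('a set \<Rightarrow> real) \<Rightarrow> real \<Rightarrow> real
     \<Rightarrow> nat \<Rightarrow> (nat \<Rightarrow> 'a set set) \<Rightarrow> (nat \<Rightarrow> real) \<Rightarrow> (nat \<Rightarrow> 'a set set) \<Rightarrow> (nat \<Rightarrow> real) \<Rightarrow> bool" where
  "greedy_run V E w c B' \<Delta> k Fs bs Es rs \<longleftrightarrow>
     1 \<le> k \<and> Fs 0 = {} \<and> bs 0 = 0 \<and> Es 0 = E \<and>
     (\<forall>i<k. rs (Suc i) = rstar E w c B' (Es i) \<and>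
        (\<exists>Cs. greedy_choice E w c B' (Es i) Cs \<and>
              Es (Suc i) = Es i - Cs \<and> bs (Suc i) = bs i + cost c Cs \<and> Fs (Suc i) = Fs i \<union> Cs)) \<and>
     (\<forall>i. 1 \<le> i \<and> i < k \<longrightarrow>
        0 < rs i \<and> bs i < (1 + 2 * log 2 (real (card V))) * B' \<and> pG V E w (Fs i) < ereal \<Delta>) \<and>
     \<not> (0 < rs k \<and> bs k < (1 + 2 * log 2 (real (card V))) * B' \<and> pG V E w (Fs k) < ereal \<Delta>)"

definition greedy_output ::
  "'a set \<Rightarrow> 'a set set \<Rightarrow> ('a set \<Rightarrow> real) \<Rightarrow> ('a set \<Rightarrow> real) \<Rightarrow> real \<Rightarrow> real \<Rightarrow> 'a set set \<Rightarrow> bool" where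
  "greedy_output V E w c B' \<Delta> Out \<longleftrightarrow>
     (\<exists>k Fs bs Es rs. greedy_run V E w c B' \<Delta> k Fs bs Es rs \<and>
        Out = (if pG V E w (Fs k) \<ge> ereal \<Delta> then Fs k else {}))"

end

theory Submission
  imports Defs
begin

text \<open>Write the minimum spanning tree weight as a sum over weight levels of the number of components of
  the graph of lighter edges. This is supermodular in the set of removed edges, and removing a greedy cut
  raises it by at least \<open>r\<^sup>* c(C\<^sup>*)\<close>. Conversely, removing any set \<open>S\<close> of cost at most \<open>B'\<close> raises it by at most
  \<open>2 log n \<cdot> r\<^sup>* \<cdot> c(S)\<close>: at each level, the components cut off by \<open>S\<close> that fill at most half of the
  component they come from fall into \<open>log n\<close> dyadic size classes, and each class costs every edge of \<open>S\<close>
  at most twice. Applied to the parts \<open>S\<close> of \<open>F\<^sup>*\<close>, this shows that a potential with initial value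
  \<open>(1 + 2 log n) B\<close> drops by at least the cost of each greedy step and stays positive while the
  target is missed. Hence the budget cannot run out first.\<close>

section \<open>Components\<close>

lemma reach_refl [simp]: "reach A u u"
  by (simp add: reach_def)

lemma reach_trans: "reach A u v \<Longrightarrow> reach A v x \<Longrightarrow> reach A u x"
  by (auto simp: reach_def)

lemma reach_sym: "reach A u v \<Longrightarrow> reach A v u"
proof -
  have "sym {(x, y). {x, y} \<in> A}"
    by (auto simp: sym_def insert_commute)
  then show "reach A u v \<Longrightarrow> reach A v u"
    unfolding reach_def by (meson sym_rtrancl symD)
qed

lemma reach_edge: "{u, v} \<in> A \<Longrightarrow> reach A u v"
  by (auto simp: reach_def)

lemma reach_mono: "A \<subseteq> B \<Longrightarrow> reach A u v \<Longrightarrow> reach B u v"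
  unfolding reach_def using rtrancl_mono[of "{(x, y). {x, y} \<in> A}" "{(x, y). {x, y} \<in> B}"] by blast

lemma reach_induct [consumes 1, case_names refl step]:
  assumes "reach A u v" and "P u"
    and "\<And>x y. reach A u x \<Longrightarrow> {x, y} \<in> A \<Longrightarrow> P x \<Longrightarrow> P y"
  shows "P v"
  using assms(1) unfolding reach_def
proof (induction rule: rtrancl_induct)
  case base
  show ?case by fact
next
  case (step y z)
  then show ?case using assms(3) by (auto simp: reach_def)
qed

lemma reach_bind:
  assumes "reach A u v" and "\<And>x y. {x, y} \<in> A \<Longrightarrow> reach B x y"
  shows "reach B u v"
  using assms(1) by (induction rule: reach_induct) (auto intro: reach_trans assms(2))

lemma reach_crossing_edge:
  assumes "reach A u v" "u \<in> M" "v \<notin> M"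
  shows "\<exists>x\<in>M. \<exists>y. y \<notin> M \<and> {x, y} \<in> A"
proof (rule ccontr)
  assume none: "\<not> ?thesis"
  have "v \<in> M"
    using assms(1) by (induction rule: reach_induct) (use assms(2) none in auto)
  then show False using assms(3) by simp
qed

text \<open>A walk can be shortened until it uses the new edge at most once, in one of its two
  directions.\<close>

lemma reach_insert_iff:
  "reach (insert {p, q} A) a b \<longleftrightarrow>
     reach A a b \<or> (reach A a p \<and> reach A q b) \<or> (reach A a q \<and> reach A p b)"
  (is "?l \<longleftrightarrow> ?r b")
proof
  assume ?l
  then show "?r b"
  proof (induction rule: reach_induct)
    case (step x y)
    show ?case
    proof (cases "{x, y} \<in> A")
      case True
      then show ?thesis using step.IH by (meson reach_edge reach_trans)
    next
      case False
      then have "{x, y} = {p, q}" using step.hyps by auto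
      then have "(x = p \<and> y = q) \<or> (x = q \<and> y = p)"
        by (auto simp: doubleton_eq_iff)
      then show ?thesis using step.IH by (meson reach_refl)
    qed
  qed simp
next
  have "reach (insert {p, q} A) p q" by (simp add: reach_edge)
  moreover have "\<And>u v. reach A u v \<Longrightarrow> reach (insert {p, q} A) u v"
    by (rule reach_mono[of A]) auto
  ultimately show "?r b \<Longrightarrow> ?l"
    by (meson reach_sym reach_trans)
qed

section \<open>Components, and how their number changes with the edges\<close>

definition component :: "'a set \<Rightarrow> 'a set set \<Rightarrow> 'a \<Rightarrow> 'a set" where
  "component V A v = {u \<in> V. reach A v u}"

definition ncomp :: "'a set \<Rightarrow> 'a set set \<Rightarrow> nat" where
  "ncomp V A = card (component V A ` V)"

lemma component_subset: "component V A v \<subseteq> V"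
  by (auto simp: component_def)

lemma component_self: "v \<in> V \<Longrightarrow> v \<in> component V A v"
  by (simp add: component_def)

lemma component_eq: "reach A u v \<Longrightarrow> component V A u = component V A v"
  by (auto simp: component_def intro: reach_trans reach_sym)

lemma component_eq_iff:
  "v \<in> V \<Longrightarrow> component V A u = component V A v \<longleftrightarrow> reach A u v"
  using component_eq component_self by (fastforce simp: component_def)

lemma ncomp_connected:
  assumes "connected_graph V A" "V \<noteq> {}"
  shows "ncomp V A = 1"
proof -
  have "component V A ` V = {V}"
    using assms by (auto simp: component_def connected_graph_def image_iff)
  then show ?thesis by (simp add: ncomp_def)
qed

lemma ncomp_cong:
  "(\<And>u v. reach A u v \<longleftrightarrow> reach B u v) \<Longrightarrow> ncomp V A = ncomp V B"
  by (simp add: ncomp_def component_def)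

text \<open>A new edge merges the components of its ends and leaves all others alone. The inductions
  below add one edge at a time with it.\<close>

lemma ncomp_insert:
  assumes "finite V" "u \<in> V" "v \<in> V"
  shows "ncomp V A = ncomp V (insert {u, v} A) + (if reach A u v then 0 else 1)"
proof (cases "reach A u v")
  case True
  then have "reach (insert {u, v} A) a b \<longleftrightarrow> reach A a b" for a b
    unfolding reach_insert_iff by (meson reach_sym reach_trans)
  then have "ncomp V (insert {u, v} A) = ncomp V A"
    by (rule ncomp_cong)
  then show ?thesis using True by simp
next
  case False
  let ?B = "insert {u, v} A" and ?cu = "component V A u" and ?cv = "component V A v"
  let ?R = "component V A ` V - {?cu, ?cv}"
  have merged: "component V ?B x = ?cu \<union> ?cv" if "reach A x u \<or> reach A x v" for x
    using that by (auto simp: component_def reach_insert_iff intro: reach_trans reach_sym)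
  have other: "component V ?B x = component V A x" if "\<not> reach A x u" "\<not> reach A x v" for x
    using that by (auto simp: component_def reach_insert_iff)
  have in_R: "component V A x \<in> ?R \<longleftrightarrow> \<not> reach A x u \<and> \<not> reach A x v" if "x \<in> V" for x
    using that assms by (simp add: component_eq_iff)
  have "component V ?B ` V = insert (?cu \<union> ?cv) ?R"
  proof (intro equalityI subsetI)
    fix X assume "X \<in> component V ?B ` V"
    then obtain x where "x \<in> V" "X = component V ?B x" by auto
    then show "X \<in> insert (?cu \<union> ?cv) ?R"
      using merged[of x] other[of x] in_R[of x] by auto
  next
    fix X assume "X \<in> insert (?cu \<union> ?cv) ?R"
    then consider "X = ?cu \<union> ?cv" | x where "x \<in> V" "X = component V A x" "X \<in> ?R" by auto
    then show "X \<in> component V ?B ` V"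
    proof cases
      case 1
      then show ?thesis using merged[of u] assms by (metis image_eqI reach_refl)
    next
      case 2
      then show ?thesis using other[of x] in_R[of x] by (metis image_eqI)
    qed
  qed
  \<comment> \<open>The merged set is new, so \<open>insert\<close> adds exactly one element to
    \<open>?R\<close>.\<close>
  moreover have "?cu \<union> ?cv \<notin> ?R"
  proof
    assume "?cu \<union> ?cv \<in> ?R"
    then obtain x where "x \<in> V" "?cu \<union> ?cv = component V A x" "component V A x \<in> ?R" by auto
    then have "\<not> reach A x u" "u \<in> component V A x"
      using in_R component_self[OF assms(2), of A] by blast+
    then show False by (simp add: component_def)
  qed
  ultimately have "ncomp V ?B = Suc (card ?R)"
    using assms(1) by (simp add: ncomp_def)
  moreover have "?cu \<noteq> ?cv" using False assms by (simp add: component_eq_iff)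
  then have "ncomp V A = card ?R + 2"
  proof -
    have "card {?cu, ?cv} = 2" using \<open>?cu \<noteq> ?cv\<close> by simp
    moreover have "{?cu, ?cv} \<subseteq> component V A ` V" using assms by auto
    ultimately show ?thesis
      unfolding ncomp_def using assms(1)
      by (metis card_Diff_subset card_mono finite.emptyI finite.insertI finite_imageI le_add_diff_inverse2)
  qed
  ultimately show ?thesis using False by simp
qed

text \<open>Edges added to the larger graph merge less often: ends already joined over
  \<open>A\<close> are joined over \<open>B\<close> as well.\<close>

lemma ncomp_union_supermodular:
  assumes "finite V" "finite X" "A \<subseteq> B" "\<And>e. e \<in> X \<Longrightarrow> \<exists>u\<in>V. \<exists>v\<in>V. e = {u, v}"
  shows "ncomp V B + ncomp V (A \<union> X) \<le> ncomp V A + ncomp V (B \<union> X)"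
  using assms(2,4)
proof (induction X rule: finite_induct)
  case (insert e X)
  obtain u v where e: "e = {u, v}" "u \<in> V" "v \<in> V" using insert.prems by blast
  have "reach (A \<union> X) u v \<Longrightarrow> reach (B \<union> X) u v"
    by (rule reach_mono[of "A \<union> X"]) (use assms(3) in auto)
  then show ?case
    using ncomp_insert[OF assms(1) e(2,3), of "A \<union> X"] ncomp_insert[OF assms(1) e(2,3), of "B \<union> X"]
      insert.IH insert.prems e(1) by (auto split: if_splits)
qed simp

lemma ncomp_union_le:
  assumes "finite V" "finite X" "\<And>e. e \<in> X \<Longrightarrow> \<exists>u\<in>V. \<exists>v\<in>V. e = {u, v}"
  shows "ncomp V (A \<union> X) \<le> ncomp V A"
  using assms(2,3)
proof (induction X rule: finite_induct)
  case (insert e X)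
  obtain u v where e: "e = {u, v}" "u \<in> V" "v \<in> V" using insert.prems by blast
  then show ?case
    using ncomp_insert[OF assms(1) e(2,3), of "A \<union> X"] insert
    by (auto split: if_splits)
qed simp

section \<open>Minimum spanning trees by levels\<close>

text \<open>Distance to the next lower level, with \<open>0\<close> as the ground level. A sum over
  levels weighted by \<open>gap\<close> thus integrates a step function of the threshold.\<close>

definition gap :: "real set \<Rightarrow> real \<Rightarrow> real" where
  "gap L W = W - Max (insert 0 {W' \<in> L. W' < W})"

lemma gap_nonneg:
  assumes "finite L" "0 \<le> W"
  shows "0 \<le> gap L W"
  using assms by (simp add: gap_def)

text \<open>The gaps telescope; the induction peels off the top level \<open>b\<close> and continues
  from the level just below it.\<close>

lemma sum_gap:
  assumes "finite L" "\<forall>W\<in>L. 0 \<le> W" "a \<in> insert 0 L" "b \<in> insert 0 L" "a \<le> b"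
  shows "(\<Sum>W\<in>{W \<in> L. a < W \<and> W \<le> b}. gap L W) = b - a"
  using assms(4,5)
proof (induction "card {W \<in> L. W < b}" arbitrary: b rule: less_induct)
  case less
  show ?case
  proof (cases "a = b")
    case True
    then have empty: "{W \<in> L. a < W \<and> W \<le> b} = {}" by auto
    show ?thesis unfolding empty using True by simp
  next
    case False
    then have "a < b" using less.prems by simp
    have "0 \<le> a" using assms by auto
    then have "b \<in> L" using less.prems \<open>a < b\<close> by auto
    let ?P = "insert 0 {W \<in> L. W < b}"
    define b' where "b' = Max ?P"
    have fin: "finite ?P" using assms(1) by simp
    have b'_mem: "b' \<in> ?P" unfolding b'_def by (rule Max_in) (use fin in auto)
    then have "b' < b" using \<open>0 \<le> a\<close> \<open>a < b\<close> by auto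
    have "a \<in> ?P" using assms(3) \<open>a < b\<close> by auto
    then have "a \<le> b'" unfolding b'_def using fin by (intro Max_ge)
    have le_b': "W \<le> b'" if "W \<in> L" "W < b" for W
      unfolding b'_def using fin that by (intro Max_ge) auto
    have "{W \<in> L. a < W \<and> W \<le> b} = insert b {W \<in> L. a < W \<and> W \<le> b'}"
      using \<open>b \<in> L\<close> \<open>a < b\<close> \<open>b' < b\<close> le_b' by force
    moreover have "b \<notin> {W \<in> L. a < W \<and> W \<le> b'}" using \<open>b' < b\<close> by simp
    ultimately have "(\<Sum>W\<in>{W \<in> L. a < W \<and> W \<le> b}. gap L W)
        = gap L b + (\<Sum>W\<in>{W \<in> L. a < W \<and> W \<le> b'}. gap L W)"
      using assms(1) by simp
    also have "(\<Sum>W\<in>{W \<in> L. a < W \<and> W \<le> b'}. gap L W) = b' - a"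
    proof (cases "b' \<in> L")
      case True
      then have "{W \<in> L. W < b'} \<subset> {W \<in> L. W < b}" using \<open>b' < b\<close> by auto
      then have "card {W \<in> L. W < b'} < card {W \<in> L. W < b}"
        using assms(1) by (intro psubset_card_mono) auto
      then show ?thesis using less.hyps True \<open>a \<le> b'\<close> by simp
    next
      case False
      then have "b' = 0" using b'_mem by auto
      then have "a = 0" using \<open>a \<le> b'\<close> \<open>0 \<le> a\<close> by simp
      then show ?thesis using \<open>b' = 0\<close> by (auto intro!: sum.neutral)
    qed
    finally show ?thesis by (simp add: gap_def b'_def)
  qed
qed

text \<open>The layer-cake formula for the weight of a minimum spanning tree. For disconnected graphs it stays
  finite: it behaves as if all pairs of vertices were joined by edges of the largest weight in
  \<^term>\<open>L\<close>.\<close>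

definition level_sum :: "'a set \<Rightarrow> real set \<Rightarrow> ('a set \<Rightarrow> real) \<Rightarrow> 'a set set \<Rightarrow> real" where
  "level_sum V L w A = (\<Sum>W\<in>L. gap L W * (real (ncomp V {f \<in> A. w f < W}) - 1))"

section \<open>Level sums of subgraphs\<close>

locale weighted_graph =
  fixes V :: "'a set" and E :: "'a set set" and w :: "'a set \<Rightarrow> real"
  assumes graph: "simple_graph V E" and w_nonneg: "\<forall>f\<in>E. 0 \<le> w f" and V_nonempty: "V \<noteq> {}"
begin

text \<open>The levels come from the whole graph \<open>E\<close> even when \<open>M\<close> is
  taken of a subgraph, so values for different subgraphs compare level by level.\<close>

abbreviation L where "L \<equiv> w ` E"
abbreviation below where "below A W \<equiv> {f \<in> A. w f < W}"
abbreviation M where "M \<equiv> level_sum V L w"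

lemma finite_V [simp]: "finite V"
  using graph by (simp add: simple_graph_def)

lemma edge_ends: "e \<in> E \<Longrightarrow> \<exists>u\<in>V. \<exists>v\<in>V. e = {u, v}"
  using graph by (fastforce simp: simple_graph_def)

lemma finite_E [simp]: "finite E"
proof (rule finite_subset)
  show "E \<subseteq> Pow V" using edge_ends by blast
qed simp

lemma L_nonneg: "\<forall>W\<in>L. 0 \<le> W"
  using w_nonneg by auto

lemma gap_L_nonneg: "W \<in> L \<Longrightarrow> 0 \<le> gap L W"
  using L_nonneg by (intro gap_nonneg) auto

lemma ncomp_antimono:
  assumes "A \<subseteq> B" "B \<subseteq> E"
  shows "ncomp V B \<le> ncomp V A"
proof -
  have "finite B" using assms(2) finite_E finite_subset by blast
  then show ?thesis
    using ncomp_union_le[of V B A] assms edge_ends by (metis finite_V subsetD sup.absorb2)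
qed

lemma level_sum_antimono:
  assumes "A \<subseteq> B" "B \<subseteq> E"
  shows "M B \<le> M A"
  unfolding level_sum_def
proof (intro sum_mono mult_left_mono)
  fix W assume "W \<in> L"
  then show "0 \<le> gap L W" by (rule gap_L_nonneg)
  have "ncomp V (below B W) \<le> ncomp V (below A W)"
    using assms by (intro ncomp_antimono) auto
  then show "real (ncomp V (below B W)) - 1 \<le> real (ncomp V (below A W)) - 1" by simp
qed

lemma level_sum_supermodular:
  assumes "A \<subseteq> B" "B \<subseteq> E" "X \<subseteq> E"
  shows "M B + M (A \<union> X) \<le> M A + M (B \<union> X)"
proof -
  have "gap L W * (real (ncomp V (below B W)) - 1) + gap L W * (real (ncomp V (below (A \<union> X) W)) - 1)
     \<le> gap L W * (real (ncomp V (below A W)) - 1) + gap L W * (real (ncomp V (below (B \<union> X) W)) - 1)"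
    if "W \<in> L" for W
  proof -
    have "finite X" using assms(3) finite_E finite_subset by blast
    then have "ncomp V (below B W) + ncomp V (below A W \<union> below X W)
        \<le> ncomp V (below A W) + ncomp V (below B W \<union> below X W)"
      by (intro ncomp_union_supermodular) (use assms edge_ends in auto)
    moreover have "below A W \<union> below X W = below (A \<union> X) W" "below B W \<union> below X W = below (B \<union> X) W"
      by auto
    ultimately have "ncomp V (below B W) + ncomp V (below (A \<union> X) W)
        \<le> ncomp V (below A W) + ncomp V (below (B \<union> X) W)"
      by (simp only:)
    then have "real (ncomp V (below B W)) + real (ncomp V (below (A \<union> X) W))
        \<le> real (ncomp V (below A W)) + real (ncomp V (below (B \<union> X) W))"
      by linarith
    then have "gap L W * ((real (ncomp V (below B W)) - 1) + (real (ncomp V (below (A \<union> X) W)) - 1))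
        \<le> gap L W * ((real (ncomp V (below A W)) - 1) + (real (ncomp V (below (B \<union> X) W)) - 1))"
      using gap_L_nonneg[OF that] by (intro mult_left_mono) auto
    then show ?thesis by (simp only: distrib_left)
  qed
  then show ?thesis
    unfolding level_sum_def sum.distrib[symmetric] by (intro sum_mono)
qed

text \<open>Each weight is the telescoping sum of the gaps up to it; exchanging the two sums counts
  edges per level.\<close>

lemma sum_weights_by_levels:
  assumes "T \<subseteq> E"
  shows "sum w T = (\<Sum>W\<in>L. gap L W * real (card {e \<in> T. W \<le> w e}))"
proof -
  have fin: "finite T" using assms finite_E finite_subset by blast
  have "w e = (\<Sum>W\<in>L. if W \<le> w e then gap L W else 0)" if "e \<in> T" for e
  proof -
    have "e \<in> E" using that assms by auto
    have "w e = (\<Sum>W\<in>{W \<in> L. 0 < W \<and> W \<le> w e}. gap L W)"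
      using sum_gap[of L 0 "w e"] L_nonneg \<open>e \<in> E\<close> by simp
    also have "\<dots> = (\<Sum>W\<in>L. if 0 < W \<and> W \<le> w e then gap L W else 0)"
      by (simp add: sum.inter_filter)
    also have "\<dots> = (\<Sum>W\<in>L. if W \<le> w e then gap L W else 0)"
    proof (rule sum.cong)
      fix W assume "W \<in> L"
      \<comment> \<open>The level \<open>0\<close>, which \<open>sum_gap\<close> leaves out, has gap
        \<open>0\<close>.\<close>
      have "gap L 0 = 0"
      proof -
        have empty: "{W' \<in> L. W' < 0} = {}" using L_nonneg by force
        show ?thesis unfolding gap_def empty by simp
      qed
      then show "(if 0 < W \<and> W \<le> w e then gap L W else 0) = (if W \<le> w e then gap L W else 0)"
        using L_nonneg \<open>W \<in> L\<close> by (cases "W = 0") force+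
    qed simp
    finally show ?thesis .
  qed
  then have "sum w T = (\<Sum>e\<in>T. \<Sum>W\<in>L. if W \<le> w e then gap L W else 0)"
    by (intro sum.cong) auto
  also have "\<dots> = (\<Sum>W\<in>L. \<Sum>e\<in>T. if W \<le> w e then gap L W else 0)"
    by (rule sum.swap)
  also have "\<dots> = (\<Sum>W\<in>L. gap L W * real (card {e \<in> T. W \<le> w e}))"
    using fin by (intro sum.cong refl) (simp add: sum.inter_filter[symmetric] mult.commute)
  finally show ?thesis .
qed

section \<open>Spanning trees and the level formula for their least weight\<close>

lemma connected_contains_spanning_tree:
  assumes "A \<subseteq> E" "connected_graph V A"
  shows "\<exists>T. spanning_tree V A T"
proof -
  let ?P = "\<lambda>T. T \<subseteq> A \<and> connected_graph V T"
  have "?P A" using assms by simp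
  then obtain T where T: "?P T" and least: "\<And>T'. ?P T' \<Longrightarrow> card T \<le> card T'"
    using ex_has_least_nat[of ?P A card] by blast
  have "finite T" using T assms(1) finite_E finite_subset by (metis order_trans)
  then have "\<not> connected_graph V (T - {e})" if "e \<in> T" for e
    using least[of "T - {e}"] T that card_Diff1_less[of T e] by auto
  then show ?thesis using T by (auto simp: spanning_tree_def)
qed

text \<open>The tree must join \<open>a\<close> and \<open>b\<close> through some edge
  \<open>g\<close> of weight at least \<open>W\<close>; replacing \<open>g\<close> by the lighter
  \<open>{a, b}\<close> keeps the graph connected and lowers the weight.\<close>

lemma spanning_tree_exchange:
  assumes A: "A \<subseteq> E" and T: "spanning_tree V A T"
    and ab: "{a, b} \<in> A" "w {a, b} < W" "\<not> reach (below T W) a b"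
  shows "\<exists>T'. spanning_tree V A T' \<and> sum w T' < sum w T"
proof -
  have TA: "T \<subseteq> A" and conn: "connected_graph V T" using T by (auto simp: spanning_tree_def)
  have fin: "finite T" using TA A finite_E finite_subset by (metis order_trans)
  have abV: "a \<in> V" "b \<in> V" using ab(1) A edge_ends by (metis doubleton_eq_iff subsetD)+
  let ?H = "{e \<in> T. W \<le> w e}"
  \<comment> \<open>In a smallest set \<open>Y\<close> of heavy tree edges that, with the light
    ones, joins \<open>a\<close> to \<open>b\<close>, every edge is indispensable. This replaces an
    argument about paths in the tree.\<close>
  let ?P = "\<lambda>Y. Y \<subseteq> ?H \<and> reach (below T W \<union> Y) a b"
  have "below T W \<union> ?H = T" by auto
  then have "?P ?H" using conn abV by (simp add: connected_graph_def)
  then obtain Y where Y: "?P Y" and least: "\<And>Y'. ?P Y' \<Longrightarrow> card Y \<le> card Y'"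
    using ex_has_least_nat[of ?P ?H card] by blast
  have finY: "finite Y" using Y by (intro finite_subset[OF _ fin]) auto
  have "Y \<noteq> {}" using Y ab(3) by auto
  then obtain g where g: "g \<in> Y" by auto
  let ?Z = "below T W \<union> (Y - {g})"
  have gT: "g \<in> T" "W \<le> w g" using g Y by auto
  obtain p q where pq: "p \<in> V" "q \<in> V" "g = {p, q}" using edge_ends gT TA A by blast
  have "\<not> reach ?Z a b"
    using least[of "Y - {g}"] Y g finY card_Diff1_less[of Y g] by (auto simp: not_le)
  moreover have "reach (insert {p, q} ?Z) a b"
  proof -
    have "insert {p, q} ?Z = below T W \<union> Y" using g pq by auto
    then show ?thesis using Y by simp
  qed
  ultimately have cyc: "(reach ?Z a p \<and> reach ?Z q b) \<or> (reach ?Z a q \<and> reach ?Z p b)"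
    by (simp add: reach_insert_iff)
  let ?S = "insert {a, b} (T - {g})"
  have ZS: "reach ?Z x y \<Longrightarrow> reach ?S x y" for x y
    by (rule reach_mono[of ?Z]) (use Y gT in auto)
  have "reach ?S a b" by (simp add: reach_edge)
  then have "reach ?S p q" using cyc ZS by (meson reach_sym reach_trans)
  have edges: "reach ?S x y" if "{x, y} \<in> T" for x y
  proof (cases "{x, y} = g")
    case True
    then show ?thesis using \<open>reach ?S p q\<close> pq by (auto simp: doubleton_eq_iff intro: reach_sym)
  next
    case False
    then show ?thesis using that by (intro reach_edge) auto
  qed
  have "reach ?S x y" if "reach T x y" for x y
    using that edges by (rule reach_bind)
  then have "connected_graph V ?S"
    using conn by (simp add: connected_graph_def)
  moreover have SA: "?S \<subseteq> A" using ab TA by auto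
  \<comment> \<open>\<open>?S\<close> only has to contain a spanning tree: with nonnegative weights
    that tree weighs no more than \<open>?S\<close>.\<close>
  ultimately obtain T' where T': "spanning_tree V ?S T'"
    using connected_contains_spanning_tree[of ?S] A by blast
  have nS: "\<forall>e\<in>?S. 0 \<le> w e" using SA A w_nonneg by blast
  have "T' \<subseteq> ?S" using T' by (simp add: spanning_tree_def)
  then have "sum w T' \<le> sum w ?S"
    using fin nS by (intro sum_mono2) auto
  also have "\<dots> \<le> w {a, b} + sum w (T - {g})"
    using fin nS by (simp add: sum.insert_if)
  also have "\<dots> < sum w T"
    using sum.remove[OF fin gT(1), of w] ab(2) gT(2) by simp
  finally have "sum w T' < sum w T" .
  moreover have "spanning_tree V A T'"
    using T' SA by (auto simp: spanning_tree_def)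
  ultimately show ?thesis by blast
qed

text \<open>By minimality no tree edge joins ends already connected by other tree edges, so every
  added edge removes exactly one component.\<close>

lemma ncomp_union_tree:
  assumes tree: "spanning_tree V A T" and "A \<subseteq> E" "B \<subseteq> T" "X \<subseteq> T" "B \<inter> X = {}" "finite X"
  shows "ncomp V B = ncomp V (B \<union> X) + card X"
  using assms(6,4,5)
proof (induction X rule: finite_induct)
  case (insert e X)
  have "e \<in> E" using insert.prems assms by (auto simp: spanning_tree_def)
  then obtain u v where e: "e = {u, v}" "u \<in> V" "v \<in> V" using edge_ends by blast
  have "\<not> reach (B \<union> X) u v"
  proof
    assume "reach (B \<union> X) u v"
    moreover have "B \<union> X \<subseteq> T - {e}" using insert assms(3) by auto
    ultimately have uv: "reach (T - {e}) u v" using reach_mono by metis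
    have edges: "reach (T - {e}) x y" if "{x, y} \<in> T" for x y
    proof (cases "{x, y} = e")
      case True
      then show ?thesis using uv e by (auto simp: doubleton_eq_iff intro: reach_sym)
    qed (use that in \<open>auto intro: reach_edge\<close>)
    have "reach (T - {e}) x y" if "reach T x y" for x y
      using that edges by (rule reach_bind)
    then have "connected_graph V (T - {e})"
      using tree by (auto simp: spanning_tree_def connected_graph_def)
    then show False using tree insert.prems by (auto simp: spanning_tree_def)
  qed
  then show ?case
    using insert ncomp_insert[OF finite_V e(2,3), of "B \<union> X"] e(1) by auto
qed simp

text \<open>By the exchange, the edges of a lightest spanning tree below a level connect the same
  vertices as all edges of \<open>A\<close> below it. So the components at level \<open>W\<close>,
  less one, are counted by the tree edges of weight at least \<open>W\<close>.\<close>

lemma MST_eq_level_sum: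
  assumes A: "A \<subseteq> E" and conn: "connected_graph V A"
  shows "MST V A w = ereal (M A)"
proof -
  let ?S = "{T. spanning_tree V A T}"
  have "finite A" using A finite_E finite_subset by blast
  then have fin: "finite ?S"
    by (rule finite_subset[rotated, OF finite_Pow_iff[THEN iffD2]]) (auto simp: spanning_tree_def)
  have ne: "?S \<noteq> {}" using connected_contains_spanning_tree[OF A conn] by auto
  then obtain T where T: "spanning_tree V A T" and least: "\<And>T'. spanning_tree V A T' \<Longrightarrow> sum w T \<le> sum w T'"
    using arg_min_least[OF fin ne, where f = "sum w"] arg_min_if_finite(1)[OF fin ne, where f = "sum w"] by auto
  have TA: "T \<subseteq> A" "connected_graph V T" using T by (auto simp: spanning_tree_def)
  have finT: "finite T" using TA \<open>finite A\<close> finite_subset by blast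
  have "sum w T = M A"
  proof -
    have "real (ncomp V (below A W)) - 1 = real (card {e \<in> T. W \<le> w e})" for W
    proof -
      have "reach (below A W) u v \<longleftrightarrow> reach (below T W) u v" for u v
      proof
        have edges: "reach (below T W) x y" if "{x, y} \<in> below A W" for x y
          using spanning_tree_exchange[OF A T] least that by force
        show "reach (below T W) u v" if "reach (below A W) u v"
          using that edges by (rule reach_bind)
        show "reach (below T W) u v \<Longrightarrow> reach (below A W) u v"
          by (rule reach_mono[of "below T W"]) (use TA in auto)
      qed
      then have "ncomp V (below A W) = ncomp V (below T W)" by (rule ncomp_cong)
      also have "\<dots> = ncomp V (below T W \<union> {e \<in> T. W \<le> w e}) + card {e \<in> T. W \<le> w e}"
        by (rule ncomp_union_tree[OF T A]) (use finT in auto)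
      also have "below T W \<union> {e \<in> T. W \<le> w e} = T" by auto
      finally show ?thesis using ncomp_connected[OF TA(2) V_nonempty] by simp
    qed
    then show ?thesis
      using TA A sum_weights_by_levels[of T] by (simp add: level_sum_def)
  qed
  moreover have "Min {sum w T | T. spanning_tree V A T} = sum w T"
  proof (rule Min_eqI)
    show "finite {sum w T | T. spanning_tree V A T}"
      using fin by simp
  qed (use T least in auto)
  ultimately show ?thesis using T by (auto simp: MST_def)
qed

lemma MST_disconnected:
  assumes "\<not> connected_graph V A"
  shows "MST V A w = \<infinity>"
proof -
  have "\<not> spanning_tree V A T" for T
    using assms by (auto simp: spanning_tree_def connected_graph_def intro: reach_mono)
  then show ?thesis by (simp add: MST_def)
qed

end

section \<open>The increase caused by removing a set of edges\<close>

lemma component_in_component: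
  assumes "A \<subseteq> B" "X \<in> component V A ` V" "Y \<in> component V B ` V" "X \<inter> Y \<noteq> {}"
  shows "X \<subseteq> Y"
proof -
  obtain x y where xy: "X = component V A x" "Y = component V B y" using assms by auto
  obtain z where z: "reach A x z" "reach B y z" using assms(4) xy by (auto simp: component_def)
  have "reach B x z" using z(1) assms(1) reach_mono by metis
  then have "reach B y x" using z(2) reach_sym reach_trans by metis
  then show ?thesis
    using xy assms(1) by (auto simp: component_def intro: reach_trans reach_mono)
qed

lemma component_disjoint:
  "\<lbrakk>X \<in> component V A ` V; Y \<in> component V A ` V; X \<inter> Y \<noteq> {}\<rbrakk> \<Longrightarrow> X = Y"
  using component_in_component[of A A X V Y] component_in_component[of A A Y V X]
  by (auto simp: Int_commute)

lemma component_nonempty: "X \<in> component V A ` V \<Longrightarrow> X \<noteq> {}"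
  using component_self by fastforce

definition small_components :: "'a set \<Rightarrow> 'a set set \<Rightarrow> 'a set set \<Rightarrow> 'a set set" where
  "small_components V H G =
     {X \<in> component V H ` V. \<exists>K\<in>component V G ` V. X \<subseteq> K \<and> 2 * card X \<le> card K}"

text \<open>Two components of \<^term>\<open>H\<close> inside one component of \<^term>\<open>G\<close> cannot both contain more
  than half of it, so all but at most one of them are small.\<close>

lemma ncomp_le_small_components:
  assumes "finite V" "H \<subseteq> G"
  shows "ncomp V H \<le> ncomp V G + card (small_components V H G)"
proof -
  let ?big = "component V H ` V - small_components V H G"
  have "\<exists>K. K \<in> component V G ` V \<and> X \<subseteq> K" if "X \<in> component V H ` V" for X
  proof -
    obtain x where x: "x \<in> V" "X = component V H x" using \<open>X \<in> component V H ` V\<close> by blast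
    then have "X \<inter> component V G x \<noteq> {}"
      using component_self[of x V H] component_self[of x V G] by auto
    then show ?thesis
      using component_in_component[OF assms(2) that, of "component V G x"] x by auto
  qed
  then obtain K where K: "\<And>X. X \<in> component V H ` V \<Longrightarrow> K X \<in> component V G ` V \<and> X \<subseteq> K X"
    by metis
  have "inj_on K ?big"
  proof (rule inj_onI, rule ccontr)
    fix X Y assume XY: "X \<in> ?big" "Y \<in> ?big" "K X = K Y" "X \<noteq> Y"
    have sub: "X \<subseteq> K X" "Y \<subseteq> K X" using K XY by auto
    have fin: "finite (K X)"
      using K[of X] XY component_subset assms(1) by (metis DiffD1 finite_subset imageE)
    have "card (K Z) < 2 * card Z" if "Z \<in> ?big" for Z
    proof (rule ccontr)
      assume "\<not> card (K Z) < 2 * card Z"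
      then have "Z \<in> small_components V H G"
        unfolding small_components_def using that K[of Z] by (intro CollectI conjI bexI[of _ "K Z"]) auto
      then show False using that by simp
    qed
    then have "card (K X) < 2 * card X" "card (K X) < 2 * card Y" using XY by metis+
    moreover have "X \<inter> Y = {}" using XY component_disjoint[of X V H Y] by auto
    then have "card X + card Y = card (X \<union> Y)"
      using sub fin by (metis card_Un_disjoint finite_subset)
    moreover have "card (X \<union> Y) \<le> card (K X)" using sub fin by (intro card_mono) auto
    ultimately show False by linarith
  qed
  then have "card ?big \<le> ncomp V G"
    unfolding ncomp_def using K assms(1) by (intro card_inj_on_le[of K]) auto
  moreover have "ncomp V H = card ?big + card (small_components V H G)"
    unfolding ncomp_def
  proof -
    have sub: "small_components V H G \<subseteq> component V H ` V" by (auto simp: small_components_def)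
    have fin: "finite (component V H ` V)" using assms(1) by simp
    show "card (component V H ` V) = card ?big + card (small_components V H G)"
      using card_mono[OF fin sub] card_Diff_subset[OF finite_subset[OF sub fin] sub] by simp
  qed
  ultimately show ?thesis by simp
qed

text \<open>The edge boundary of \<open>X\<close> within \<open>S\<close>.\<close>

definition crossing :: "'a set set \<Rightarrow> 'a set \<Rightarrow> 'a set set" where
  "crossing S X = {e \<in> S. e \<inter> X \<noteq> {} \<and> \<not> e \<subseteq> X}"

text \<open>Each of the two ends lies in at most one member of a disjoint family.\<close>

lemma card_disjoint_meeting:
  assumes "\<And>X Y. X \<in> F \<Longrightarrow> Y \<in> F \<Longrightarrow> X \<inter> Y \<noteq> {} \<Longrightarrow> X = Y"
  shows "card {X \<in> F. {u, v} \<inter> X \<noteq> {}} \<le> 2"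
proof -
  have one: "\<exists>Y. {X \<in> F. x \<in> X} \<subseteq> {Y}" for x
  proof (cases "\<exists>Y\<in>F. x \<in> Y")
    case True
    then obtain Y where "Y \<in> F" "x \<in> Y" by blast
    then have "{X \<in> F. x \<in> X} \<subseteq> {Y}" using assms by blast
    then show ?thesis ..
  qed auto
  obtain Yu Yv where "{X \<in> F. u \<in> X} \<subseteq> {Yu}" "{X \<in> F. v \<in> X} \<subseteq> {Yv}" using one by meson
  then have "{X \<in> F. {u, v} \<inter> X \<noteq> {}} \<subseteq> {Yu, Yv}" by blast
  then have "card {X \<in> F. {u, v} \<inter> X \<noteq> {}} \<le> card {Yu, Yv}" by (intro card_mono) auto
  also have "\<dots> \<le> 2" by (simp add: card_insert_if)
  finally show ?thesis .
qed

context weighted_graph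
begin

text \<open>The increase of the number of components at a level is at most the number of small components.
  Those whose size lies in a fixed dyadic class are charged to the maximal ones \<open>Y\<close> of the class, taken
  over all levels. The sets \<open>Y\<close> are disjoint, so their boundaries use every edge at most twice. All levels
  charged to \<open>Y\<close> exceed the weight of the cheapest edge leaving \<open>Y\<close>, because a component
  twice as large as a member of the class does not fit into \<open>Y\<close>.\<close>

lemma level_sum_increase_bound:
  assumes G: "G \<subseteq> E" and S: "S \<subseteq> G" and c: "\<forall>f\<in>S. 0 \<le> c f" and r: "0 \<le> r"
    and cut: "\<And>W X u v. \<lbrakk>W \<in> L; u \<in> X; v \<in> V - X; {u, v} \<in> G; w {u, v} < W;
        crossing (below (G - S) W) X = {}\<rbrakk> \<Longrightarrow> W - w {u, v} \<le> r * sum c (crossing S X)"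
  shows "M (G - S) - M G \<le> 2 * log 2 (real (card V)) * r * sum c S"
proof -
  define small where "small i W =
    {X \<in> small_components V (below (G - S) W) (below G W). 2 ^ i \<le> card X \<and> card X < 2 ^ Suc i}" for i W
  have finite_small: "finite (small i W)" for i W
    by (auto simp: small_def small_components_def)
  have S_fin: "finite S" using S G finite_E by (meson finite_subset)
  have size_class: "(\<Sum>W\<in>L. gap L W * real (card (small i W))) \<le> 2 * r * sum c S" for i
  proof -
    \<comment> \<open>The class is collected over all levels at once; it is laminar, so its maximal
      members are disjoint.\<close>
    define Fam where "Fam = (\<Union>W\<in>L. small i W)"
    define Top where "Top = {X \<in> Fam. \<forall>Y\<in>Fam. X \<subseteq> Y \<longrightarrow> X = Y}"
    have finFam: "finite Fam" unfolding Fam_def using finite_small by simp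
    then have finTop: "finite Top" by (simp add: Top_def)
    have small_comp: "X \<in> component V (below (G - S) W) ` V" if "X \<in> small i W" for X W
      using that by (simp add: small_def small_components_def)
    have fin_small: "finite X" if "X \<in> small i W" for X W
    proof (rule finite_subset)
      show "X \<subseteq> V" using small_comp[OF that] component_subset by fastforce
    qed simp
    have laminar: "X \<subseteq> Y" if "X \<in> small i W" "Y \<in> small i W'" "W \<le> W'" "X \<inter> Y \<noteq> {}" for X Y W W'
    proof (rule component_in_component[OF _ small_comp small_comp])
      show "below (G - S) W \<subseteq> below (G - S) W'" using \<open>W \<le> W'\<close> by auto
    qed (use that in auto)
    have Top_disjoint: "X = Y" if XY: "X \<in> Top" "Y \<in> Top" "X \<inter> Y \<noteq> {}" for X Y
    proof -
      obtain W W' where W: "X \<in> small i W" "Y \<in> small i W'"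
        using XY by (auto simp: Top_def Fam_def)
      consider "W \<le> W'" | "W' \<le> W" by linarith
      then have "X \<subseteq> Y \<or> Y \<subseteq> X"
        by cases (use laminar W XY in \<open>auto simp: Int_commute\<close>)
      then show ?thesis using XY by (auto simp: Top_def)
    qed
    have below_Top: "\<exists>Y\<in>Top. X \<subseteq> Y" if "X \<in> Fam" for X
    proof -
      obtain Y where Y: "Y \<in> Fam" "X \<subseteq> Y" "\<forall>Z\<in>Fam. Y \<subseteq> Z \<longrightarrow> Y = Z"
        using finite_has_maximal2[OF finFam \<open>X \<in> Fam\<close>] by auto
      then have "Y \<in> Top" by (simp add: Top_def)
      then show ?thesis using Y(2) ..
    qed
    define lev where "lev Y = {W \<in> L. \<exists>X\<in>small i W. X \<subseteq> Y}" for Y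
    \<comment> \<open>Two members at one level are disjoint and of size at least
      \<open>2 ^ i\<close> each, so they cannot share a set of \<open>Top\<close>, whose size is
      below \<open>2 ^ Suc i\<close>.\<close>
    have count: "real (card (small i W)) \<le> (\<Sum>Y\<in>Top. if W \<in> lev Y then 1 else 0)" if "W \<in> L" for W
    proof -
      have "\<exists>Y\<in>Top. X \<subseteq> Y" if "X \<in> small i W" for X
        using below_Top that \<open>W \<in> L\<close> by (auto simp: Fam_def)
      then obtain t where t: "\<And>X. X \<in> small i W \<Longrightarrow> t X \<in> Top \<and> X \<subseteq> t X" by metis
      have "inj_on t (small i W)"
      proof (rule inj_onI, rule ccontr)
        fix X Y assume XY: "X \<in> small i W" "Y \<in> small i W" "t X = t Y" "X \<noteq> Y"
        then have "X \<inter> Y = {}"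
          using component_disjoint[OF small_comp[OF XY(1)] small_comp[OF XY(2)]] by blast
        have "t X \<in> Top" using t XY(1) by blast
        then obtain W' where "t X \<in> small i W'" by (auto simp: Top_def Fam_def)
        then have tX: "card (t X) < 2 ^ Suc i" "finite (t X)"
          by (simp add: small_def, rule fin_small)
        have "X \<union> Y \<subseteq> t X" using t[of X] t[of Y] XY by auto
        then have "card (X \<union> Y) < 2 ^ Suc i"
          using card_mono[OF tX(2)] tX(1) by (meson le_less_trans)
        moreover have "card (X \<union> Y) = card X + card Y"
          using \<open>X \<inter> Y = {}\<close> XY fin_small by (intro card_Un_disjoint) auto
        moreover have "2 ^ i \<le> card X" "2 ^ i \<le> card Y" using XY by (auto simp: small_def)
        ultimately show False by simp
      qed
      moreover have "t ` small i W \<subseteq> {Y \<in> Top. W \<in> lev Y}"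
        using t \<open>W \<in> L\<close> by (auto simp: lev_def)
      ultimately have "card (small i W) \<le> card {Y \<in> Top. W \<in> lev Y}"
        using finTop by (intro card_inj_on_le[of t]) auto
      also have "real (card {Y \<in> Top. W \<in> lev Y}) = (\<Sum>Y\<in>Top. if W \<in> lev Y then 1 else 0)"
        using finTop by (simp add: sum.inter_filter[symmetric])
      finally show ?thesis by simp
    qed
    have charge: "sum (gap L) (lev Y) \<le> r * sum c (crossing S Y)" if "Y \<in> Top" for Y
    proof -
      have finlev: "finite {W \<in> L. Y \<in> small i W}" by simp
      have nelev: "{W \<in> L. Y \<in> small i W} \<noteq> {}" using that by (auto simp: Top_def Fam_def)
      \<comment> \<open>The highest level at which \<open>Y\<close> itself is in the class. A member
        inside \<open>Y\<close> at a higher level would contain \<open>Y\<close> by laminarity and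
        so equal it.\<close>
      define U where "U = Max {W \<in> L. Y \<in> small i W}"
      have U: "U \<in> L" "Y \<in> small i U" using Max_in[OF finlev nelev] by (auto simp: U_def)
      have finY: "finite Y" using U fin_small by blast
      have le_U: "W \<le> U" if W: "W \<in> lev Y" for W
      proof (rule ccontr)
        assume "\<not> W \<le> U"
        obtain X where X: "X \<in> small i W" "X \<subseteq> Y" using W by (auto simp: lev_def)
        then have "X \<inter> Y \<noteq> {}" using component_nonempty[OF small_comp] by blast
        then have "Y \<subseteq> X" using laminar[OF U(2) X(1)] \<open>\<not> W \<le> U\<close> by auto
        then have "Y \<in> small i W" using X by auto
        then have "W \<le> U" using W finlev unfolding U_def by (intro Max_ge) (auto simp: lev_def)
        then show False using \<open>\<not> W \<le> U\<close> by simp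
      qed
      \<comment> \<open>The component of \<open>below G W\<close> around \<open>X\<close> has at
        least \<open>2 ^ Suc i\<close> vertices, too many for \<open>Y\<close>, so a path in it
        leaves \<open>Y\<close> by an edge lighter than \<open>W\<close>.\<close>
      have leaving: "\<exists>u v. u \<in> Y \<and> v \<in> V - Y \<and> {u, v} \<in> G \<and> w {u, v} < W" if W: "W \<in> lev Y" for W
      proof -
        obtain X where X: "X \<in> small i W" "X \<subseteq> Y" using W by (auto simp: lev_def)
        then obtain K where K: "K \<in> component V (below G W) ` V" "X \<subseteq> K" "2 * card X \<le> card K"
          by (auto simp: small_def small_components_def)
        have "2 ^ i \<le> card X" "card Y < 2 ^ Suc i" using X U by (auto simp: small_def)
        then have "card Y < card K" using K(3) by simp
        then have "\<not> K \<subseteq> Y" using card_mono[OF finY, of K] by auto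
        then obtain b where b: "b \<in> K" "b \<notin> Y" by blast
        obtain a where a: "a \<in> X" using component_nonempty[OF small_comp[OF X(1)]] by blast
        have "reach (below G W) a b"
          using K(1,2) a b(1) by (auto simp: component_def intro: reach_trans reach_sym)
        then obtain x y where xy: "x \<in> Y" "y \<notin> Y" "{x, y} \<in> below G W"
          using reach_crossing_edge[of "below G W" a b Y] a b(2) X(2) by blast
        moreover have "y \<in> V" using xy G edge_ends by (fastforce simp: doubleton_eq_iff)
        ultimately show ?thesis by blast
      qed
      define D where "D = {e \<in> G. \<exists>u v. e = {u, v} \<and> u \<in> Y \<and> v \<in> V - Y}"
      have finD: "finite D" by (rule finite_subset[OF _ finite_subset[OF G finite_E]]) (auto simp: D_def)
      show ?thesis
      proof (cases "lev Y = {}")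
        case True
        have "0 \<le> sum c (crossing S Y)" using c by (intro sum_nonneg) (auto simp: crossing_def)
        then show ?thesis using True r by simp
      next
        case False
        then have "D \<noteq> {}" using leaving by (fastforce simp: D_def)
        obtain e where e: "e \<in> D" "\<And>f. f \<in> D \<Longrightarrow> w e \<le> w f"
          using arg_min_if_finite(1)[OF finD \<open>D \<noteq> {}\<close>, where f = w]
            arg_min_least[OF finD \<open>D \<noteq> {}\<close>, where f = w] by blast
        obtain u v where uv: "e = {u, v}" "u \<in> Y" "v \<in> V - Y" "{u, v} \<in> G"
          using e(1) by (auto simp: D_def)
        have above: "w e < W" if W: "W \<in> lev Y" for W
        proof -
          obtain u' v' where "u' \<in> Y" "v' \<in> V - Y" "{u', v'} \<in> G" "w {u', v'} < W"
            using leaving[OF W] by blast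
          then show ?thesis using e(2)[of "{u', v'}"] by (force simp: D_def)
        qed
        have "w e < U" using False above le_U by fastforce
        \<comment> \<open>All levels of \<open>lev Y\<close> lie above the cheapest edge
          \<open>e\<close> leaving \<open>Y\<close> and not above \<open>U\<close>, so their gaps
          sum to at most \<open>U - w e\<close>.\<close>
        have "sum (gap L) (lev Y) \<le> sum (gap L) {W \<in> L. w e < W \<and> W \<le> U}"
          using above le_U gap_L_nonneg by (intro sum_mono2) (auto simp: lev_def)
        also have "\<dots> = U - w e"
          using U(1) \<open>w e < U\<close> uv G L_nonneg by (intro sum_gap) auto
        also have "\<dots> \<le> r * sum c (crossing S Y)"
          unfolding uv(1)
        proof (rule cut[OF U(1) uv(2,3,4)])
          show "w {u, v} < U" using \<open>w e < U\<close> uv(1) by simp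
          show "crossing (below (G - S) U) Y = {}"
          proof (rule ccontr)
            assume "crossing (below (G - S) U) Y \<noteq> {}"
            then obtain f where f: "f \<in> below (G - S) U" "f \<inter> Y \<noteq> {}" "\<not> f \<subseteq> Y"
              by (auto simp: crossing_def)
            then obtain x y where xy: "f = {x, y}" "x \<in> V" "y \<in> V" using edge_ends G by blast
            have "x \<in> Y \<longleftrightarrow> y \<in> Y"
              using small_comp[OF U(2)] reach_edge[of x y "below (G - S) U"] f(1) xy
              by (auto simp: component_def intro: reach_trans reach_sym)
            then show False using f xy by auto
          qed
        qed
        finally show ?thesis .
      qed
    qed
    have "(\<Sum>W\<in>L. gap L W * real (card (small i W)))
        \<le> (\<Sum>W\<in>L. gap L W * (\<Sum>Y\<in>Top. if W \<in> lev Y then 1 else 0))"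
      using count gap_L_nonneg by (intro sum_mono mult_left_mono)
    also have "\<dots> = (\<Sum>Y\<in>Top. \<Sum>W\<in>L. if W \<in> lev Y then gap L W else 0)"
      by (subst sum.swap) (simp add: sum_distrib_left if_distrib cong: if_cong)
    also have "\<dots> = (\<Sum>Y\<in>Top. sum (gap L) (lev Y))"
    proof (rule sum.cong[OF refl])
      fix Y
      have "lev Y \<subseteq> L" by (auto simp: lev_def)
      then have "{W \<in> L. W \<in> lev Y} = lev Y" by blast
      then show "(\<Sum>W\<in>L. if W \<in> lev Y then gap L W else 0) = sum (gap L) (lev Y)"
        using sum.inter_filter[of L "gap L" "\<lambda>W. W \<in> lev Y"] by simp
    qed
    also have "\<dots> \<le> (\<Sum>Y\<in>Top. r * sum c (crossing S Y))"
      using charge by (intro sum_mono)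
    also have "\<dots> = r * (\<Sum>Y\<in>Top. \<Sum>e\<in>S. if e \<in> crossing S Y then c e else 0)"
    proof -
      have "sum c (crossing S Y) = (\<Sum>e\<in>S. if e \<in> crossing S Y then c e else 0)" for Y
        using S_fin by (simp add: sum.inter_filter[symmetric] crossing_def)
      then show ?thesis by (simp add: sum_distrib_left)
    qed
    also have "(\<Sum>Y\<in>Top. \<Sum>e\<in>S. if e \<in> crossing S Y then c e else 0)
        = (\<Sum>e\<in>S. c e * real (card {Y \<in> Top. e \<in> crossing S Y}))"
      by (subst sum.swap) (simp add: sum.inter_filter[symmetric] finTop mult.commute)
    also have "r * \<dots> \<le> r * (\<Sum>e\<in>S. c e * 2)"
    proof (intro mult_left_mono[OF _ r] sum_mono mult_left_mono)
      fix e assume "e \<in> S"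
      then obtain u v where uv: "e = {u, v}" using S G edge_ends by blast
      have "card {Y \<in> Top. e \<in> crossing S Y} \<le> card {Y \<in> Top. {u, v} \<inter> Y \<noteq> {}}"
        using finTop uv by (intro card_mono) (auto simp: crossing_def)
      also have "\<dots> \<le> 2" by (rule card_disjoint_meeting) (rule Top_disjoint)
      finally show "real (card {Y \<in> Top. e \<in> crossing S Y}) \<le> 2" by simp
    qed (use c in auto)
    also have "\<dots> = 2 * r * sum c S" by (simp add: sum_distrib_right[symmetric])
    finally show ?thesis .
  qed
  define m where "m = nat \<lfloor>log 2 (real (card V))\<rfloor>"
  have cardV: "1 \<le> card V" using V_nonempty by (simp add: Suc_leI card_gt_0_iff)
  have m_le: "real m \<le> log 2 (real (card V))" using cardV by (simp add: m_def)
  have split: "card (small_components V (below (G - S) W) (below G W)) \<le> (\<Sum>i<m. card (small i W))" for W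
  proof -
    have "small_components V (below (G - S) W) (below G W) \<subseteq> (\<Union>i<m. small i W)"
    proof
      fix X assume X: "X \<in> small_components V (below (G - S) W) (below G W)"
      then obtain k where K: "X \<in> component V (below (G - S) W) ` V"
          "2 * card X \<le> card (component V (below G W) k)"
        by (auto simp: small_components_def)
      have "X \<noteq> {}" using K(1) by (rule component_nonempty)
      moreover have "X \<subseteq> V" using K(1) component_subset by fastforce
      then have "finite X" using finite_V finite_subset by blast
      ultimately have "1 \<le> card X" by (simp add: Suc_leI card_gt_0_iff)
      then obtain i where i: "2 ^ i \<le> card X" "card X < 2 ^ Suc i" using ex_power_ivl1[of 2 "card X"] by auto
      \<comment> \<open>A small component fills at most half of another one. This shifts the
        exponent by one, so that \<open>m\<close> classes suffice instead of
        \<open>m + 1\<close>.\<close>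
      have "2 ^ Suc i \<le> card V"
        using i(1) K(2) card_mono[OF finite_V component_subset[of V "below G W" k]] by simp
      then have "real (Suc i) \<le> log 2 (real (card V))" by (rule le_log2_of_power)
      then have "Suc i \<le> m" unfolding m_def by (simp add: le_nat_floor)
      then show "X \<in> (\<Union>i<m. small i W)" using X i by (auto simp: small_def)
    qed
    then have "card (small_components V (below (G - S) W) (below G W)) \<le> card (\<Union>i<m. small i W)"
      using finite_small by (intro card_mono) auto
    also have "\<dots> \<le> (\<Sum>i<m. card (small i W))" by (rule card_UN_le) simp
    finally show ?thesis .
  qed
  have "M (G - S) - M G
      = (\<Sum>W\<in>L. gap L W * (real (ncomp V (below (G - S) W)) - real (ncomp V (below G W))))"
    unfolding level_sum_def sum_subtractf[symmetric] by (intro sum.cong) (auto simp: algebra_simps)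
  also have "\<dots> \<le> (\<Sum>W\<in>L. gap L W * (\<Sum>i<m. real (card (small i W))))"
  proof (intro sum_mono mult_left_mono gap_L_nonneg)
    fix W
    have "ncomp V (below (G - S) W) \<le> ncomp V (below G W) + (\<Sum>i<m. card (small i W))"
      using ncomp_le_small_components[OF finite_V, of "below (G - S) W" "below G W"] split[of W] by force
    then have "real (ncomp V (below (G - S) W)) \<le> real (ncomp V (below G W) + (\<Sum>i<m. card (small i W)))"
      by (rule of_nat_mono)
    then show "real (ncomp V (below (G - S) W)) - real (ncomp V (below G W))
        \<le> (\<Sum>i<m. real (card (small i W)))" by simp
  qed
  also have "\<dots> = (\<Sum>i<m. \<Sum>W\<in>L. gap L W * real (card (small i W)))"
    by (subst sum.swap) (simp add: sum_distrib_left)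
  also have "\<dots> \<le> (\<Sum>i<m. 2 * r * sum c S)" using size_class by (intro sum_mono)
  also have "\<dots> = real m * (2 * r * sum c S)" by simp
  also have "\<dots> \<le> log 2 (real (card V)) * (2 * r * sum c S)"
    using m_le r c by (intro mult_right_mono) (auto intro!: mult_nonneg_nonneg sum_nonneg)
  finally show ?thesis by (simp add: mult_ac)
qed

end

section \<open>The greedy procedure\<close>

text \<open>One greedy step: \<open>a\<close> and \<open>z\<close> are the costs it spends inside and outside the optimal set,
  \<open>y\<close> is the cost of the part of the optimal set not yet removed, \<open>g\<close> is the gain, \<open>q\<close> the gain due to the
  optimal set alone, and \<open>\<delta> \<le> s\<close> are the corresponding deficits.\<close>

lemma potential_step:
  fixes a d g q r s \<delta> x y z :: real
  assumes x: "0 < x" and a: "0 \<le> a" "a < y" and z: "0 \<le> z"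
    and q: "0 \<le> q" "q \<le> g" and \<delta>: "g < \<delta>" "\<delta> \<le> s"
    and rate: "s \<le> x * r * y" "q \<le> x * r * a" and gain: "r * (a + z) \<le> g"
  shows "a + z + (y - a) + x * (y - a) * ((\<delta> - g) / (s - q)) \<le> y + x * y * (\<delta> / s)"
proof -
  have s: "0 < s" "0 < s - q" using q \<delta> by auto
  have y: "0 < y" "0 < y - a" using a by auto
  have "0 < x * r * y" using rate(1) s(1) by linarith
  then have r: "0 < r" using x y(1) by (simp add: zero_less_mult_iff)
  \<comment> \<open>Since \<open>a + (y - a) = y\<close>, only \<open>z\<close> remains to be paid
    from the drop of the second term.\<close>
  have "z \<le> x * (y * (\<delta> / s) - (y - a) * ((\<delta> - g) / (s - q)))"
  \<comment> \<open>Either the part of cost \<open>a\<close> gains at most at the average rate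
    \<open>s / y\<close>, and the bound on \<open>s\<close> pays for \<open>z\<close>; or it gains
    faster, and the bound on \<open>q\<close> pays.\<close>
  proof (cases "q * y \<le> s * a")
    case True
    have "(y - a) / (s - q) \<le> y / s"
      using True s y by (simp add: divide_simps algebra_simps)
    then have ratio: "(y - a) / (s - q) * (\<delta> - g) \<le> y / s * (\<delta> - g)"
      using \<delta> by (intro mult_right_mono) auto
    have "r * z \<le> g" using gain r a(1) by (simp add: distrib_left) (smt (verit) mult_nonneg_nonneg)
    then have "s * (r * z) \<le> (x * r * y) * g"
      using rate(1) s(1) r z by (intro mult_mono) auto
    then have z_le: "z \<le> x * (y / s * g)"
      using r s(1) by (simp add: divide_simps mult_ac)
    have "y / s * g = y * (\<delta> / s) - y / s * (\<delta> - g)"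
      by (simp add: divide_simps algebra_simps)
    also have "\<dots> \<le> y * (\<delta> / s) - (y - a) / (s - q) * (\<delta> - g)"
      using ratio by (rule diff_left_mono)
    also have "(y - a) / (s - q) * (\<delta> - g) = (y - a) * ((\<delta> - g) / (s - q))" by simp
    finally have "y / s * g \<le> y * (\<delta> / s) - (y - a) * ((\<delta> - g) / (s - q))" .
    then have "x * (y / s * g) \<le> x * (y * (\<delta> / s) - (y - a) * ((\<delta> - g) / (s - q)))"
      using x by (intro mult_left_mono) auto
    then show ?thesis using z_le by linarith
  next
    case False
    have q_pos: "0 < q"
    proof (rule ccontr)
      assume "\<not> 0 < q"
      then have "q = 0" using q by simp
      then show False using False s a by simp
    qed
    then have "0 < x * r * a" using rate(2) by linarith
    then have a_pos: "0 < a" using zero_less_mult_pos mult_pos_pos[OF x r] by blast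
    have slope: "y / s \<le> (y - a) / (s - q)"
      using False s y by (simp add: divide_simps algebra_simps)
    \<comment> \<open>By \<open>slope\<close> the right-hand side decreases in \<delta>; the
      left-hand side is its value at the extreme \<delta> = s.\<close>
    have worst: "a + (g - q) * ((y - a) / (s - q)) \<le> y * (\<delta> / s) - (y - a) * ((\<delta> - g) / (s - q))"
    proof -
      have "(s - \<delta>) * (y / s) \<le> (s - \<delta>) * ((y - a) / (s - q))"
        using slope \<delta> by (intro mult_left_mono) auto
      moreover have "(s - \<delta>) * (y / s) = y - y * (\<delta> / s)" using s by (simp add: field_simps)
      moreover have "(s - q) * ((y - a) / (s - q)) = y - a" using s by simp
      moreover have "(y - a) * ((\<delta> - g) / (s - q)) = (\<delta> - g) * ((y - a) / (s - q))" by simp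
      ultimately show ?thesis by (simp only: left_diff_distrib)
    qed
    have "a / q \<le> (y - a) / (s - q)"
      using False s q_pos by (simp add: divide_simps algebra_simps)
    then have "(g - q) * (a / q) \<le> (g - q) * ((y - a) / (s - q))"
      using q(2) by (intro mult_left_mono) auto
    moreover have "a + (g - q) * (a / q) = g * (a / q)" using q_pos by (simp add: field_simps)
    ultimately have "g * (a / q) \<le> y * (\<delta> / s) - (y - a) * ((\<delta> - g) / (s - q))"
      using worst by linarith
    then have "x * (g * (a / q)) \<le> x * (y * (\<delta> / s) - (y - a) * ((\<delta> - g) / (s - q)))"
      using x by (intro mult_left_mono) auto
    moreover have "z \<le> x * (g * (a / q))"
    proof -
      have "q * (a + z) * r \<le> x * r * a * g"
      proof -
        have "q * (r * (a + z)) \<le> (x * r * a) * g"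
          using rate(2) gain q r a z by (intro mult_mono) auto
        then show ?thesis by (simp add: mult_ac)
      qed
      then have "q * (a + z) \<le> x * a * g" using r by (simp add: mult_ac)
      moreover have "0 \<le> q * a" using q a by simp
      ultimately have "q * z \<le> x * a * g" by (simp add: distrib_left)
      then show ?thesis using q_pos by (simp add: field_simps)
    qed
    ultimately show ?thesis by linarith
  qed
  then show ?thesis by (simp add: algebra_simps)
qed

section \<open>Costs, candidates and the greedy ratio\<close>

locale interdiction_graph = weighted_graph V E w
  for V :: "'a set" and E and w +
  fixes c :: "'a set \<Rightarrow> real" and B' :: real
  assumes c_pos: "\<forall>f\<in>E. 0 < c f"
begin

lemma cost_mono:
  assumes "A \<subseteq> A'" "A' \<subseteq> E"
  shows "cost c A \<le> cost c A'"
  unfolding cost_def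
proof (rule sum_mono2)
  show "finite A'" using assms finite_E finite_subset by blast
qed (use assms c_pos in force)+

lemma cost_pos:
  assumes "A \<subseteq> E" "A \<noteq> {}"
  shows "0 < cost c A"
  unfolding cost_def
proof (rule sum_pos)
  show "finite A" using assms finite_E finite_subset by blast
qed (use assms c_pos in auto)

lemma cost_Un:
  assumes "A \<union> A' \<subseteq> E" "A \<inter> A' = {}"
  shows "cost c (A \<union> A') = cost c A + cost c A'"
  unfolding cost_def using assms finite_E by (intro sum.union_disjoint) (auto intro: finite_subset)

lemma candidate_subset: "candidate E w c B' G e W C \<Longrightarrow> C \<subseteq> G"
  by (auto simp: candidate_def min_cost_sep_def separates_def)

lemma finite_cand_ratios:
  assumes "G \<subseteq> E"
  shows "finite (cand_ratios E w c B' G)"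
proof (rule finite_subset)
  show "cand_ratios E w c B' G \<subseteq> (\<lambda>(e, W, C). (W - w e) / cost c C) ` (G \<times> L \<times> Pow G)"
  proof
    fix x assume "x \<in> cand_ratios E w c B' G"
    then obtain e W C where x: "x = (W - w e) / cost c C" "candidate E w c B' G e W C"
      by (auto simp: cand_ratios_def)
    then have "(e, W, C) \<in> G \<times> L \<times> Pow G"
      using candidate_subset[OF x(2)] by (auto simp: candidate_def)
    then show "x \<in> (\<lambda>(e, W, C). (W - w e) / cost c C) ` (G \<times> L \<times> Pow G)"
      unfolding x(1) by (rule rev_image_eqI) simp
  qed
  show "finite ((\<lambda>(e, W, C). (W - w e) / cost c C) ` (G \<times> L \<times> Pow G))"
    using finite_subset[OF assms finite_E] by simp
qed

lemma rstar_nonneg: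
  assumes "G \<subseteq> E"
  shows "0 \<le> rstar E w c B' G"
  unfolding rstar_def using finite_cand_ratios[OF assms] by (intro Max_ge) auto

lemma candidate_ratio_le_rstar:
  assumes "G \<subseteq> E" "candidate E w c B' G e W C"
  shows "(W - w e) / cost c C \<le> rstar E w c B' G"
  unfolding rstar_def using finite_cand_ratios[OF assms(1)] assms(2)
  by (intro Max_ge) (auto simp: cand_ratios_def)

text \<open>Supplies the hypothesis \<open>cut\<close> of \<open>level_sum_increase_bound\<close>.
  The edges of \<open>crossing S X\<close> lighter than \<open>W\<close> separate \<open>u\<close>
  from \<open>v\<close>, so a cheapest separator is a candidate that costs no more than they
  do.\<close>

lemma rstar_bounds_cut:
  assumes G: "G \<subseteq> E" and S: "S \<subseteq> G" "cost c S \<le> B'"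
    and W: "W \<in> L" and uv: "u \<in> X" "v \<in> V - X" "{u, v} \<in> G" "w {u, v} < W"
    and iso: "crossing (below (G - S) W) X = {}"
  shows "W - w {u, v} \<le> rstar E w c B' G * sum c (crossing S X)"
proof -
  let ?C0 = "below (crossing S X) W"
  let ?Seps = "{C. separates (below G W) C u v}"
  have sep: "separates (below G W) ?C0 u v"
    unfolding separates_def
  proof
    show "?C0 \<subseteq> below G W" using S by (auto simp: crossing_def)
    show "\<not> reach (below G W - ?C0) u v"
    proof
      assume "reach (below G W - ?C0) u v"
      then obtain x y where xy: "x \<in> X" "y \<notin> X" "{x, y} \<in> below G W - ?C0"
        using reach_crossing_edge[of _ u v X] uv by blast
      then have "{x, y} \<in> crossing (below (G - S) W) X" by (auto simp: crossing_def)
      then show False using iso by simp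
    qed
  qed
  have "?Seps \<subseteq> Pow G" by (auto simp: separates_def)
  then have fin: "finite ?Seps" using finite_subset[OF G finite_E] by (meson finite_Pow_iff finite_subset)
  have ne: "?Seps \<noteq> {}" using sep by auto
  obtain C where C: "separates (below G W) C u v" "\<And>C'. separates (below G W) C' u v \<Longrightarrow> cost c C \<le> cost c C'"
    using arg_min_if_finite(1)[OF fin ne, where f = "cost c"] arg_min_least[OF fin ne, where f = "cost c"]
    by blast
  have crossE: "crossing S X \<subseteq> S" "S \<subseteq> E" using S G by (auto simp: crossing_def)
  have "cost c C \<le> cost c ?C0" using C(2) sep by blast
  also have "\<dots> \<le> cost c (crossing S X)" using crossE by (intro cost_mono) auto
  finally have le: "cost c C \<le> cost c (crossing S X)" .
  \<comment> \<open>The edge \<open>{u, v}\<close> itself lies below \<open>W\<close>, so no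
    separator is free; a candidate needs positive cost.\<close>
  have "C \<noteq> {}"
  proof
    assume "C = {}"
    then have "\<not> reach (below G W) u v" using C(1) by (simp add: separates_def)
    then show False using uv by (simp add: reach_edge)
  qed
  moreover have "C \<subseteq> E" using C(1) G by (auto simp: separates_def)
  ultimately have pos: "0 < cost c C" by (intro cost_pos)
  have "cost c C \<le> B'" using le cost_mono[OF crossE] S(2) by linarith
  then have "candidate E w c B' G {u, v} W C"
    using C W uv pos by (auto simp: candidate_def min_cost_sep_def)
  then have "(W - w {u, v}) / cost c C \<le> rstar E w c B' G"
    by (rule candidate_ratio_le_rstar[OF G])
  then have "W - w {u, v} \<le> rstar E w c B' G * cost c C"
    using pos by (simp add: pos_divide_le_eq)
  also have "\<dots> \<le> rstar E w c B' G * cost c (crossing S X)"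
    using le rstar_nonneg[OF G] by (rule mult_left_mono)
  finally show ?thesis by (simp add: cost_def)
qed

lemma level_sum_increase_le_rstar:
  assumes "G \<subseteq> E" "S \<subseteq> G" "cost c S \<le> B'"
  shows "M (G - S) - M G \<le> 2 * log 2 (real (card V)) * rstar E w c B' G * cost c S"
  unfolding cost_def
proof (rule level_sum_increase_bound)
  show "\<forall>f\<in>S. 0 \<le> c f" using assms c_pos by force
qed (use assms rstar_nonneg rstar_bounds_cut in auto)

text \<open>On every level above \<open>w e\<close> and up to \<open>W\<close> the cut separates the
  ends of \<open>e\<close>, which \<open>e\<close> itself joined before. That is at least one more
  component there, and the gaps of these levels sum to \<open>W - w e\<close>.\<close>

lemma candidate_gain:
  assumes G: "G \<subseteq> E" and cand: "candidate E w c B' G e W C" and less: "w e < W"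
  shows "W - w e \<le> M (G - C) - M G"
proof -
  obtain u v where uv: "e = {u, v}" "separates (below G W) C u v"
    using cand by (auto simp: candidate_def min_cost_sep_def)
  have e: "e \<in> G" "W \<in> L" using cand by (auto simp: candidate_def)
  have V: "u \<in> V" "v \<in> V" using edge_ends[of "{u, v}"] e G uv(1) by (auto simp: doubleton_eq_iff)
  have "W - w e = (\<Sum>W'\<in>{W' \<in> L. w e < W' \<and> W' \<le> W}. gap L W')"
    using L_nonneg e G less by (subst sum_gap) auto
  also have "\<dots> = (\<Sum>W'\<in>L. if w e < W' \<and> W' \<le> W then gap L W' else 0)"
    by (simp add: sum.inter_filter)
  also have "\<dots> \<le> (\<Sum>W'\<in>L. gap L W' * (real (ncomp V (below (G - C) W')) - real (ncomp V (below G W'))))"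
  proof (rule sum_mono)
    fix W' assume "W' \<in> L"
    have "real (if w e < W' \<and> W' \<le> W then 1 else 0)
        \<le> real (ncomp V (below (G - C) W')) - real (ncomp V (below G W'))"
    proof (cases "w e < W' \<and> W' \<le> W")
      case True
      have "\<not> reach (below (G - C) W') u v"
      proof
        assume "reach (below (G - C) W') u v"
        then have "reach (below G W - C) u v"
          by (rule reach_mono[rotated]) (use True in auto)
        then show False using uv(2) by (simp add: separates_def)
      qed
      then have "ncomp V (below (G - C) W') = ncomp V (insert e (below (G - C) W')) + 1"
        using ncomp_insert[OF finite_V V, of "below (G - C) W'"] uv(1) by simp
      moreover have "ncomp V (below G W') \<le> ncomp V (insert e (below (G - C) W'))"
        by (rule ncomp_antimono) (use True e G in auto)
      ultimately show ?thesis using True by simp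
    next
      case False
      have "ncomp V (below G W') \<le> ncomp V (below (G - C) W')"
        by (rule ncomp_antimono) (use G in auto)
      then show ?thesis using False by auto
    qed
    then have "gap L W' * real (if w e < W' \<and> W' \<le> W then 1 else 0)
        \<le> gap L W' * (real (ncomp V (below (G - C) W')) - real (ncomp V (below G W')))"
      using gap_L_nonneg[OF \<open>W' \<in> L\<close>] by (rule mult_left_mono)
    then show "(if w e < W' \<and> W' \<le> W then gap L W' else 0)
        \<le> gap L W' * (real (ncomp V (below (G - C) W')) - real (ncomp V (below G W')))"
      by (auto split: if_splits)
  qed
  also have "\<dots> = M (G - C) - M G"
    unfolding level_sum_def sum_subtractf[symmetric] by (intro sum.cong) (auto simp: algebra_simps)
  finally show ?thesis .
qed

text \<open>Putting \<open>S - F\<close> back into the smaller graph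
  \<open>E - (F \<union> S)\<close> saves at least as much as putting it back into
  \<open>E - S\<close>.\<close>

lemma removal_supermodular:
  assumes "F \<subseteq> E" "S \<subseteq> E"
  shows "M (E - S) - M (E - (F \<inter> S)) \<le> M (E - (F \<union> S)) - M (E - F)"
proof -
  have "M (E - S) + M ((E - (F \<union> S)) \<union> (S - F)) \<le> M (E - (F \<union> S)) + M ((E - S) \<union> (S - F))"
    by (rule level_sum_supermodular) (use assms in auto)
  moreover have "(E - (F \<union> S)) \<union> (S - F) = E - F" "(E - S) \<union> (S - F) = E - (F \<inter> S)"
    using assms by auto
  ultimately show ?thesis by simp
qed

text \<open>By supermodularity the increase is at most that of removing \<open>S - F\<close> from
  the current graph. Applied to the optimal set and to the part of it removed after the step, this
  gives both rates in \<open>potential_step\<close>.\<close>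

lemma rstar_lower_bound:
  assumes "F \<subseteq> E" "S \<subseteq> E" "cost c S \<le> B'"
  shows "M (E - S) - M (E - (F \<inter> S))
    \<le> 2 * log 2 (real (card V)) * rstar E w c B' (E - F) * cost c (S - F)"
proof -
  have "M (E - S) - M (E - (F \<inter> S)) \<le> M (E - (F \<union> S)) - M (E - F)"
    using assms by (intro removal_supermodular)
  also have "E - (F \<union> S) = (E - F) - (S - F)" by auto
  also have "M ((E - F) - (S - F)) - M (E - F)
      \<le> 2 * log 2 (real (card V)) * rstar E w c B' (E - F) * cost c (S - F)"
  proof (rule level_sum_increase_le_rstar)
    show "cost c (S - F) \<le> B'" using cost_mono[of "S - F" S] assms by auto
  qed (use assms in auto)
  finally show ?thesis .
qed

text \<open>While the deficit is positive, \<^term>\<open>potential S F\<close> bounds the budget that the greedy procedure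
  still needs from state \<^term>\<open>F\<close>. The last factor is the actual deficit divided by the deficit that
  would remain if only \<^term>\<open>F \<inter> S\<close> had been removed.\<close>

definition potential :: "'a set set \<Rightarrow> 'a set set \<Rightarrow> real" where
  "potential S F = cost c (S - F) + 2 * log 2 (real (card V)) * cost c (S - F) *
     ((M (E - S) - M (E - F)) / (M (E - S) - M (E - (F \<inter> S))))"

text \<open>The procedure cannot stall below the target: with ratio \<open>0\<close> the set
  \<open>F \<inter> S\<close>, and hence \<open>F\<close>, would already have the full effect of
  \<open>S\<close>.\<close>

lemma rstar_pos:
  assumes F: "F \<subseteq> E" and S: "S \<subseteq> E" "cost c S \<le> B'" and short: "M (E - F) < M (E - S)"
  shows "0 < rstar E w c B' (E - F)"
proof (rule ccontr)
  assume "\<not> ?thesis"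
  then have "rstar E w c B' (E - F) = 0" using rstar_nonneg[of "E - F"] by auto
  then have "M (E - S) \<le> M (E - (F \<inter> S))" using rstar_lower_bound[OF F S] by simp
  moreover have "M (E - (F \<inter> S)) \<le> M (E - F)" by (rule level_sum_antimono) auto
  ultimately show False using short by simp
qed

lemma potential_pos:
  assumes "F \<subseteq> E" "S \<subseteq> E" "M (E - F) < M (E - S)" "2 \<le> card V"
  shows "0 < potential S F"
proof -
  have "M (E - (F \<inter> S)) \<le> M (E - F)" by (rule level_sum_antimono) auto
  then have "0 \<le> (M (E - S) - M (E - F)) / (M (E - S) - M (E - (F \<inter> S)))" using assms(3) by simp
  moreover have "S - F \<noteq> {}"
  proof
    assume "S - F = {}"
    then have "M (E - S) \<le> M (E - F)" by (intro level_sum_antimono) auto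
    then show False using assms(3) by simp
  qed
  then have "0 < cost c (S - F)" using assms by (intro cost_pos) auto
  moreover have "0 \<le> log 2 (real (card V))" using assms by simp
  ultimately show ?thesis unfolding potential_def by (intro add_pos_nonneg mult_nonneg_nonneg) auto
qed

text \<open>An instance of \<open>potential_step\<close>: \<open>C \<inter> S\<close> costs
  \<open>a\<close>, \<open>C - S\<close> costs \<open>z\<close>, and \<open>q\<close> is the gain
  when \<open>F \<inter> S\<close> grows to \<open>(F \<union> C) \<inter> S\<close>.\<close>

lemma potential_greedy_step:
  assumes F: "F \<subseteq> E" and S: "S \<subseteq> E" "cost c S \<le> B'" and n: "2 \<le> card V"
    and cand: "candidate E w c B' (E - F) e W C"
    and opt: "(W - w e) / cost c C = rstar E w c B' (E - F)"
    and short: "M (E - (F \<union> C)) < M (E - S)"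
  shows "cost c C + potential S (F \<union> C) \<le> potential S F"
proof -
  let ?x = "2 * log 2 (real (card V))" and ?r = "rstar E w c B' (E - F)"
  have C: "C \<subseteq> E" "C \<inter> F = {}" using candidate_subset[OF cand] by auto
  have mono: "D \<subseteq> D' \<Longrightarrow> M (E - D) \<le> M (E - D')" for D D'
    by (rule level_sum_antimono) auto
  have "M (E - F) < M (E - S)" using mono[of F "F \<union> C"] short by simp
  then have r: "0 < ?r" using rstar_pos F S by blast
  have Cpos: "0 < cost c C" using cand by (simp add: candidate_def)
  then have "W - w e = ?r * cost c C" using opt by (simp add: field_simps)
  moreover have "0 < ?r * cost c C" using r Cpos by simp
  moreover have "E - F - C = E - (F \<union> C)" by auto
  ultimately have gain: "?r * cost c C \<le> M (E - (F \<union> C)) - M (E - F)"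
    using candidate_gain[OF _ cand] by simp
  have cost_C: "cost c C = cost c (C \<inter> S) + cost c (C - S)"
    using cost_Un[of "C \<inter> S" "C - S"] C by (metis Int_Diff_Un Int_Diff_disjoint)
  have split_rest: "S - F = (S - (F \<union> C)) \<union> (C \<inter> S)" using C by auto
  have "cost c (S - F) = cost c (S - (F \<union> C)) + cost c (C \<inter> S)"
    unfolding split_rest by (rule cost_Un) (use S in auto)
  then have rest: "cost c (S - (F \<union> C)) = cost c (S - F) - cost c (C \<inter> S)" by simp
  have "S - (F \<union> C) \<noteq> {}"
  proof
    assume "S - (F \<union> C) = {}"
    then show False using mono[of S "F \<union> C"] short by auto
  qed
  then have "0 < cost c (S - (F \<union> C))" using S by (intro cost_pos) auto
  then have a_less: "cost c (C \<inter> S) < cost c (S - F)" using rest by simp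
  have a_nonneg: "0 \<le> cost c (C \<inter> S)" "0 \<le> cost c (C - S)"
    using cost_mono[of "{}" "C \<inter> S"] cost_mono[of "{}" "C - S"] C by (auto simp: cost_def)
  let ?D = "F \<inter> S" and ?D' = "(F \<union> C) \<inter> S"
  \<comment> \<open>Supermodularity compares the gain of \<open>C \<inter> S\<close> on top of
    \<open>F \<inter> S\<close> with that on top of \<open>F\<close>; the rest of \<open>C\<close>
    only adds.\<close>
  have q_le: "M (E - ?D') - M (E - ?D) \<le> M (E - (F \<union> C)) - M (E - F)"
  proof -
    have "F \<inter> ?D' = ?D" by auto
    then have "M (E - ?D') - M (E - ?D) \<le> M (E - (F \<union> ?D')) - M (E - F)"
      using removal_supermodular[OF F, of ?D'] S by auto
    also have "M (E - (F \<union> ?D')) \<le> M (E - (F \<union> C))" by (rule mono) auto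
    finally show ?thesis by simp
  qed
  have rate_S: "M (E - S) - M (E - ?D) \<le> ?x * ?r * cost c (S - F)"
    using rstar_lower_bound[OF F S] .
  \<comment> \<open>Here \<open>?D'\<close> plays the role of the optimal set.\<close>
  have rate_D: "M (E - ?D') - M (E - ?D) \<le> ?x * ?r * cost c (C \<inter> S)"
  proof -
    have "F \<inter> ?D' = ?D" "?D' - F = C \<inter> S" using C by auto
    moreover have "cost c ?D' \<le> B'" using cost_mono[of ?D' S] S by auto
    ultimately show ?thesis using rstar_lower_bound[OF F, of ?D'] S by auto
  qed
  have "cost c (C \<inter> S) + cost c (C - S) + (cost c (S - F) - cost c (C \<inter> S))
      + ?x * (cost c (S - F) - cost c (C \<inter> S)) *
        ((M (E - S) - M (E - F) - (M (E - (F \<union> C)) - M (E - F)))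
          / (M (E - S) - M (E - ?D) - (M (E - ?D') - M (E - ?D))))
    \<le> cost c (S - F) + ?x * cost c (S - F) * ((M (E - S) - M (E - F)) / (M (E - S) - M (E - ?D)))"
  proof (rule potential_step[where r = ?r])
    show "0 < ?x" using n by simp
    show "0 \<le> M (E - ?D') - M (E - ?D)" using mono[of ?D ?D'] by auto
    show "?r * (cost c (C \<inter> S) + cost c (C - S)) \<le> M (E - (F \<union> C)) - M (E - F)"
      using gain cost_C by simp
    show "M (E - S) - M (E - F) \<le> M (E - S) - M (E - ?D)" using mono[of ?D F] by auto
  qed (use a_nonneg a_less q_le rate_S rate_D short in auto)
  then show ?thesis
    unfolding potential_def cost_C rest by simp
qed

text \<open>At the start both deficits agree, and being positive they have quotient
  \<open>1\<close>.\<close>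

lemma potential_empty:
  assumes "M E < M (E - S)"
  shows "potential S {} = (1 + 2 * log 2 (real (card V))) * cost c S"
  using assms by (simp add: potential_def algebra_simps)

end

section \<open>Runs of the greedy procedure and the guarantee\<close>

lemma greedy_run_step:
  assumes "greedy_run V E w c B' \<Delta> k Fs bs Es rs" "i < k"
  obtains Cs where "rs (Suc i) = rstar E w c B' (Es i)" "greedy_choice E w c B' (Es i) Cs"
    "Es (Suc i) = Es i - Cs" "bs (Suc i) = bs i + cost c Cs" "Fs (Suc i) = Fs i \<union> Cs"
  using assms unfolding greedy_run_def by blast

lemma greedy_run_invariant:
  assumes "greedy_run V E w c B' \<Delta> k Fs bs Es rs" "finite E" "i \<le> k"
  shows "Fs i \<subseteq> E \<and> Es i = E - Fs i \<and> bs i = cost c (Fs i)"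
  using assms(3)
proof (induction i)
  case 0
  then show ?case using assms(1) by (simp add: greedy_run_def cost_def)
next
  case (Suc i)
  then have IH: "Fs i \<subseteq> E" "Es i = E - Fs i" "bs i = cost c (Fs i)" by auto
  obtain Cs where Cs: "greedy_choice E w c B' (Es i) Cs" "Es (Suc i) = Es i - Cs"
      "bs (Suc i) = bs i + cost c Cs" "Fs (Suc i) = Fs i \<union> Cs"
    using greedy_run_step[OF assms(1), of i] Suc.prems by (metis Suc_le_lessD)
  have "Cs \<subseteq> E - Fs i"
    using Cs(1) IH(2)
    by (auto simp: greedy_choice_def candidate_def min_cost_sep_def separates_def split: if_splits)
  moreover have "cost c (Fs i \<union> Cs) = cost c (Fs i) + cost c Cs"
    unfolding cost_def
  proof (rule sum.union_disjoint)
    show "finite (Fs i)" "finite Cs"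
      using IH(1) \<open>Cs \<subseteq> E - Fs i\<close> assms(2) by (auto intro: finite_subset)
  qed (use \<open>Cs \<subseteq> E - Fs i\<close> in auto)
  ultimately show ?case using IH Cs(2-4) by auto
qed

theorem mainTheorem16:
  fixes V :: "'a set" and E :: "'a set set"
    and w c :: "'a set \<Rightarrow> real" and B B' \<Delta> :: real and Fstar Out :: "'a set set"
  assumes "simple_graph V E" and "connected_graph V E" and "card V \<ge> 2"
    and "\<forall>f\<in>E. w f \<ge> 0" and "\<forall>f\<in>E. c f > 0"
    and "\<Delta> > 0"
    and "Fstar \<subseteq> E" and "cost c Fstar = B" and "pG V E w Fstar = ereal \<Delta>"
    and "B' \<ge> B"
    and "\<forall>D\<subseteq>E. \<not> connected_graph V (E - D) \<longrightarrow> cost c D > B'"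
    and "greedy_output V E w c B' \<Delta> Out"
  shows "pG V E w Out \<ge> ereal \<Delta> \<and> cost c Out < (2 + 2 * log 2 (real (card V))) * B'"
proof -
  interpret interdiction_graph V E w c B'
    by unfold_locales (use assms in auto)
  let ?x = "2 * log 2 (real (card V))"
  have x_pos: "0 < ?x" using assms(3) by simp
  have mono: "D \<subseteq> D' \<Longrightarrow> M (E - D) \<le> M (E - D')" for D D'
    by (rule level_sum_antimono) auto
  have MST_E: "MST V E w = ereal (M E)" using assms(2) by (simp add: MST_eq_level_sum)
  have pG_connected: "pG V E w D = ereal (M (E - D) - M E)" if "connected_graph V (E - D)" for D
    using MST_eq_level_sum[OF _ that] MST_E by (auto simp: pG_def)
  have pG_disconnected: "pG V E w D = \<infinity>" if "\<not> connected_graph V (E - D)" for D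
    using MST_disconnected[OF that] MST_E by (simp add: pG_def)
  have "connected_graph V (E - Fstar)"
    using pG_disconnected[of Fstar] assms(9) by (cases "connected_graph V (E - Fstar)") auto
  then have \<Delta>: "\<Delta> = M (E - Fstar) - M E" using pG_connected assms(9) by simp
  \<comment> \<open>A disconnecting removal has infinite \<open>pG\<close>, so below the target the
    graph is connected and \<open>M\<close> gives the true weight.\<close>
  have below_target: "pG V E w D < ereal \<Delta> \<Longrightarrow> M (E - D) < M (E - Fstar)" for D
    using pG_connected[of D] pG_disconnected[of D] \<Delta>
    by (cases "connected_graph V (E - D)") auto
  have "Fstar \<noteq> {}" using \<Delta> assms(6) by auto
  then have "0 < B" using cost_pos[OF assms(7)] assms(8) by simp
  then have B'_pos: "0 < B'" using assms(10) by simp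
  have budget: "cost c Fstar \<le> B'" using assms(8,10) by simp

  obtain k Fs bs Es rs where run: "greedy_run V E w c B' \<Delta> k Fs bs Es rs"
    and Out: "Out = (if pG V E w (Fs k) \<ge> ereal \<Delta> then Fs k else {})"
    using assms(12) by (auto simp: greedy_output_def)
  have k: "1 \<le> k" using run by (simp add: greedy_run_def)
  have inv: "Fs i \<subseteq> E" "Es i = E - Fs i" "bs i = cost c (Fs i)" if "i \<le> k" for i
    using greedy_run_invariant[OF run finite_E that] by auto
  have step: "\<exists>Cs. greedy_choice E w c B' (E - Fs i) Cs \<and> bs (Suc i) = bs i + cost c Cs \<and>
      Fs (Suc i) = Fs i \<union> Cs" if "i < k" for i
    using greedy_run_step[OF run that] inv(2)[of i] that by (metis less_imp_le)

  \<comment> \<open>A run that ends below the target was below it all along. Then the ratios stay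
    positive and the potential keeps the spending below \<open>(1 + ?x) * B'\<close>, so no stopping
    condition holds at \<open>k\<close>.\<close>
  have reached: "ereal \<Delta> \<le> pG V E w (Fs k)"
  proof (rule ccontr)
    assume "\<not> ?thesis"
    then have short_k: "pG V E w (Fs k) < ereal \<Delta>" by simp
    have incr: "Fs i \<subseteq> Fs k" if "i \<le> k" for i
      using that
    proof (induction rule: inc_induct)
      case (step n)
      obtain Cs where "Fs (Suc n) = Fs n \<union> Cs" by (rule greedy_run_step[OF run \<open>n < k\<close>])
      then show ?case using step.IH by auto
    qed simp
    have short: "M (E - Fs i) < M (E - Fstar)" if "i \<le> k" for i
      using below_target[OF short_k] mono[OF incr[OF that]] by simp
    have rpos: "0 < rstar E w c B' (E - Fs i)" if "i \<le> k" for i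
      using rstar_pos[OF inv(1)[OF that] assms(7) budget short[OF that]] .
    have "bs i + potential Fstar (Fs i) \<le> (1 + ?x) * B" if "i \<le> k" for i
      using that
    proof (induction i)
      case 0
      have "Fs 0 = {}" "bs 0 = 0" using run by (auto simp: greedy_run_def)
      then show ?case using potential_empty[of Fstar] \<Delta> assms(6,8) by simp
    next
      case (Suc i)
      then obtain Cs where Cs: "greedy_choice E w c B' (E - Fs i) Cs"
          "bs (Suc i) = bs i + cost c Cs" "Fs (Suc i) = Fs i \<union> Cs"
        using step[of i] by auto
      then obtain e W where eW: "candidate E w c B' (E - Fs i) e W Cs"
          "(W - w e) / cost c Cs = rstar E w c B' (E - Fs i)"
        using rpos[of i] Suc.prems by (auto simp: greedy_choice_def)
      have "cost c Cs + potential Fstar (Fs i \<union> Cs) \<le> potential Fstar (Fs i)"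
        using potential_greedy_step[OF _ assms(7) budget assms(3) eW] inv(1)[of i] short[of "Suc i"] Cs(3) Suc.prems
        by simp
      then show ?case using Suc.IH Suc.prems Cs(2,3) by simp
    qed
    then have "bs k + potential Fstar (Fs k) \<le> (1 + ?x) * B" by simp
    then have "bs k < (1 + ?x) * B"
      using potential_pos[OF inv(1)[of k] assms(7) short[of k] assms(3)] by simp
    also have "\<dots> \<le> (1 + ?x) * B'" using assms(10) x_pos by (intro mult_left_mono) auto
    finally have "bs k < (1 + ?x) * B'" .
    \<comment> \<open>Step \<open>k\<close> computes \<open>rs k\<close> in the state reached after
      \<open>k - 1\<close> steps.\<close>
    moreover have "rs k = rstar E w c B' (E - Fs (k - 1))"
    proof -
      have "rs (Suc (k - 1)) = rstar E w c B' (Es (k - 1))"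
        by (rule greedy_run_step[OF run, of "k - 1"]) (use k in auto)
      then show ?thesis using inv(2)[of "k - 1"] k by simp
    qed
    then have "0 < rs k" using rpos[of "k - 1"] by simp
    ultimately show False using run short_k by (simp add: greedy_run_def)
  qed

  \<comment> \<open>The run tests the budget only after its first step; for \<open>k = 1\<close> the
    bound comes from \<open>bs 0 = 0\<close> and \<open>0 < B'\<close>. The last cut then adds at
    most \<open>B'\<close>.\<close>
  have "bs (k - 1) < (1 + ?x) * B'"
  proof (cases "k = 1")
    case True
    then show ?thesis using run B'_pos x_pos by (simp add: greedy_run_def add_pos_pos)
  next
    case False
    then have "1 \<le> k - 1" "k - 1 < k" using k by auto
    then show ?thesis using run unfolding greedy_run_def by blast
  qed
  moreover have "bs k \<le> bs (k - 1) + B'"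
  proof -
    obtain Cs where Cs: "greedy_choice E w c B' (E - Fs (k - 1)) Cs" "bs (Suc (k - 1)) = bs (k - 1) + cost c Cs"
      using step[of "k - 1"] k by auto
    have "cost c Cs \<le> B'"
      using Cs(1) B'_pos by (auto simp: greedy_choice_def candidate_def cost_def split: if_splits)
    then show ?thesis using Cs(2) k by simp
  qed
  ultimately have "bs k < (2 + ?x) * B'" by (simp add: algebra_simps)
  then show ?thesis using reached Out inv(3)[of k] by simp
qed

end
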